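(* Let $E,F^1,F^2$ be functions of $(x^0,x^1,x^2,x^3)$, let $\lambda$ be an auxiliary parameter, and let $K_\lambda,R_\lambda,P,Q,S,T$ be as in the context. Consider vector fields $$L_0=K_\lambda+m(\lambda)\partial_\lambda,\qquad L_1=R_\lambda+n(\lambda)\partial_\lambda$$ in the variables $(x^0,x^1,x^2,x^3,\lambda)$ and the condition $$[L_0,L_1]\in\operatorname{span}\{L_0,L_1\}.\tag{L}$$ Then the functions $m(\lambda)$ and $n(\lambda)$ have the form $$m(\lambda)=\tfrac13\lambda^3\psi(\lambda)+\lambda^2\varphi(\lambda),\qquad n(\lambda)=-\tfrac{\lambda^2}{3}\bigl(m(\lambda)+3\eta(\lambda)+\lambda\,\xi(\lambda)\bigr),$$ where $$\begin{aligned} \psi(\lambda)&=K_\lambda(E),\\ \varphi(\lambda)&=K_\lambda(S)-R_\lambda(P)+SR_\lambda(E)-EK_\lambda(T)+ER_\lambda(Q)-ETR_\lambda(E),\\ \xi(\lambda)&=R_\lambda(E),\\ \eta(\lambda)&=K_\lambda(T)-R_\lambda(Q)+TR_\lambda(E). \end{aligned}$$ Moreover, condition (L) is equivalent to a system of 7 PDEs for the unknown functions $F^1$, $F^2$ and $E$. The equations are of order 3 in $F^1$ and $F^2$ and of order 2 in $E$.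
   Context: Put $\partial_i=\partial/\partial x^i$ and $$K_1=\partial_1+E\partial_3,\quad R_1=\partial_3,\quad P=K_1(F^1),\quad Q=K_1(F^2),\quad S=R_1(F^1),\quad T=R_1(F^2),$$ $$K_2=\partial_0+E\partial_2+P\partial_3+Q\partial_1,\qquad R_2=\partial_2+S\partial_3+T\partial_1,$$ $$K_\lambda=K_1+\lambda K_2,\qquad R_\lambda=R_1+\lambda R_2+\tfrac13\lambda^2K_1 .$$ The frame $(K_2,K_1,R_2,R_1)$ is dual to the coframe $\omega^0=\mathrm dx^0$, $\omega^1=\mathrm dx^1-(\partial_1F^2\mathrm dx^0+\partial_3F^2\mathrm dx^2)$, $\omega^2=\mathrm dx^2-E\mathrm dx^0$, $\omega^3=\mathrm dx^3-E\mathrm dx^1-(\partial_1F^1\mathrm dx^0+\partial_3F^1\mathrm dx^2)+E(\partial_1F^2\mathrm dx^0+\partial_3F^2\mathrm dx^2)$. The 2-planes $\operatorname{span}\{K_\lambda,R_\lambda\}$ are the ruling planes of the cubic cones $\frac13(\omega^2)^3+\omega^0\omega^3\omega^3-\omega^1\omega^2\omega^3=0$ (a Cayley structure), and the existence of $m,n$ with property (L) means that the Cayley structure is half-flat: there is a 3-parameter family of surfaces in $M$ such that each ruling plane at each point is tangent to a unique member of the family. In the pair $(L_0,L_1)$, $m$ and $n$ are functions of $(x,\lambda)$ to be determined by (L): the requirement $[L_0,L_1]\in\operatorname{span}\{L_0,L_1,\partial_\lambda\}$ determines $m,n$ uniquely, and the remaining condition is the vanishing, for all $\lambda$, of the $\partial_\lambda$-component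 of $[L_0,L_1]$ relative to $L_0,L_1,\partial_\lambda$. *)

theory Defs
  imports "HOL-Analysis.Analysis"
begin

primrec higher_diff_on :: "nat \<Rightarrow> 'a::euclidean_space set \<Rightarrow> ('a \<Rightarrow> real) \<Rightarrow> bool" where
  "higher_diff_on 0 S f \<longleftrightarrow> continuous_on S f"
| "higher_diff_on (Suc k) S f \<longleftrightarrow>
     (\<forall>x\<in>S. f differentiable (at x)) \<and>
     (\<forall>v. higher_diff_on k S (\<lambda>x. frechet_derivative f (at x) v))"

text \<open>Class \<open>C\<^sup>\<infinity>\<close> on \<open>S\<close>; only meaningful for open \<open>S\<close>.\<close>

definition smooth_on :: "'a::euclidean_space set \<Rightarrow> ('a \<Rightarrow> real) \<Rightarrow> bool" where
  "smooth_on S f \<longleftrightarrow> (\<forall>k. higher_diff_on k S f)"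

text \<open>A vector field on an open subset of a Euclidean space is given by its component map.
  \<open>vact X f\<close> is the function \<open>X(f)\<close>; the bracket is the one for which
  \<open>[X,Y](f) = X(Y(f)) - Y(X(f))\<close>.\<close>

definition vact :: "('a::euclidean_space \<Rightarrow> 'a) \<Rightarrow> ('a \<Rightarrow> real) \<Rightarrow> 'a \<Rightarrow> real" where
  "vact X f = (\<lambda>x. frechet_derivative f (at x) (X x))"

definition lie_bracket ::
    "('a::euclidean_space \<Rightarrow> 'a) \<Rightarrow> ('a \<Rightarrow> 'a) \<Rightarrow> 'a \<Rightarrow> 'a" where
  "lie_bracket X Y = (\<lambda>x. frechet_derivative Y (at x) (X x) - frechet_derivative X (at x) (Y x))"

text \<open>The coordinates \<open>x\<^sup>0, x\<^sup>1, x\<^sup>2, x\<^sup>3\<close> are the components \<open>x $ 0, x $ 1, x $ 2, x $ 3\<close>, the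
  elements of the index type \<open>4\<close> being \<open>0, 1, 2, 3\<close>.\<close>

definition dd :: "4 \<Rightarrow> real^4" where
  "dd i = axis i 1"

definition K1 :: "(real^4 \<Rightarrow> real) \<Rightarrow> real^4 \<Rightarrow> real^4" where
  "K1 E = (\<lambda>x. dd 1 + E x *\<^sub>R dd 3)"

definition R1 :: "real^4 \<Rightarrow> real^4" where
  "R1 = (\<lambda>x. dd 3)"

definition funP :: "(real^4 \<Rightarrow> real) \<Rightarrow> (real^4 \<Rightarrow> real) \<Rightarrow> real^4 \<Rightarrow> real" where
  "funP E F1 = vact (K1 E) F1"

definition funQ :: "(real^4 \<Rightarrow> real) \<Rightarrow> (real^4 \<Rightarrow> real) \<Rightarrow> real^4 \<Rightarrow> real" where
  "funQ E F2 = vact (K1 E) F2"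

definition funS :: "(real^4 \<Rightarrow> real) \<Rightarrow> real^4 \<Rightarrow> real" where
  "funS F1 = vact R1 F1"

definition funT :: "(real^4 \<Rightarrow> real) \<Rightarrow> real^4 \<Rightarrow> real" where
  "funT F2 = vact R1 F2"

definition K2 :: "(real^4 \<Rightarrow> real) \<Rightarrow> (real^4 \<Rightarrow> real) \<Rightarrow> (real^4 \<Rightarrow> real) \<Rightarrow> real^4 \<Rightarrow> real^4" where
  "K2 E F1 F2 = (\<lambda>x. dd 0 + E x *\<^sub>R dd 2 + funP E F1 x *\<^sub>R dd 3 + funQ E F2 x *\<^sub>R dd 1)"

definition R2 :: "(real^4 \<Rightarrow> real) \<Rightarrow> (real^4 \<Rightarrow> real) \<Rightarrow> real^4 \<Rightarrow> real^4" where
  "R2 F1 F2 = (\<lambda>x. dd 2 + funS F1 x *\<^sub>R dd 3 + funT F2 x *\<^sub>R dd 1)"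

definition Kl ::
    "(real^4 \<Rightarrow> real) \<Rightarrow> (real^4 \<Rightarrow> real) \<Rightarrow> (real^4 \<Rightarrow> real) \<Rightarrow> real \<Rightarrow> real^4 \<Rightarrow> real^4" where
  "Kl E F1 F2 l = (\<lambda>x. K1 E x + l *\<^sub>R K2 E F1 F2 x)"

definition Rl ::
    "(real^4 \<Rightarrow> real) \<Rightarrow> (real^4 \<Rightarrow> real) \<Rightarrow> (real^4 \<Rightarrow> real) \<Rightarrow> real \<Rightarrow> real^4 \<Rightarrow> real^4" where
  "Rl E F1 F2 l = (\<lambda>x. R1 x + l *\<^sub>R R2 F1 F2 x + (1/3 * l^2) *\<^sub>R K1 E x)"

definition psi ::
    "(real^4 \<Rightarrow> real) \<Rightarrow> (real^4 \<Rightarrow> real) \<Rightarrow> (real^4 \<Rightarrow> real) \<Rightarrow> real \<Rightarrow> real^4 \<Rightarrow> real" where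
  "psi E F1 F2 l = vact (Kl E F1 F2 l) E"

definition phi ::
    "(real^4 \<Rightarrow> real) \<Rightarrow> (real^4 \<Rightarrow> real) \<Rightarrow> (real^4 \<Rightarrow> real) \<Rightarrow> real \<Rightarrow> real^4 \<Rightarrow> real" where
  "phi E F1 F2 l = (\<lambda>x.
     vact (Kl E F1 F2 l) (funS F1) x - vact (Rl E F1 F2 l) (funP E F1) x
     + funS F1 x * vact (Rl E F1 F2 l) E x
     - E x * vact (Kl E F1 F2 l) (funT F2) x
     + E x * vact (Rl E F1 F2 l) (funQ E F2) x
     - E x * funT F2 x * vact (Rl E F1 F2 l) E x)"

definition xi ::
    "(real^4 \<Rightarrow> real) \<Rightarrow> (real^4 \<Rightarrow> real) \<Rightarrow> (real^4 \<Rightarrow> real) \<Rightarrow> real \<Rightarrow> real^4 \<Rightarrow> real" where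
  "xi E F1 F2 l = vact (Rl E F1 F2 l) E"

definition eta ::
    "(real^4 \<Rightarrow> real) \<Rightarrow> (real^4 \<Rightarrow> real) \<Rightarrow> (real^4 \<Rightarrow> real) \<Rightarrow> real \<Rightarrow> real^4 \<Rightarrow> real" where
  "eta E F1 F2 l = (\<lambda>x.
     vact (Kl E F1 F2 l) (funT F2) x - vact (Rl E F1 F2 l) (funQ E F2) x
     + funT F2 x * vact (Rl E F1 F2 l) E x)"

text \<open>Vector fields in the variables \<open>(x\<^sup>0, x\<^sup>1, x\<^sup>2, x\<^sup>3, \<lambda>)\<close>, with \<open>m\<close> and \<open>n\<close> functions of
  \<open>(x, \<lambda>)\<close>.\<close>

definition L0 ::
    "(real^4 \<Rightarrow> real) \<Rightarrow> (real^4 \<Rightarrow> real) \<Rightarrow> (real^4 \<Rightarrow> real) \<Rightarrow>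
     ((real^4) \<times> real \<Rightarrow> real) \<Rightarrow> (real^4) \<times> real \<Rightarrow> (real^4) \<times> real" where
  "L0 E F1 F2 m = (\<lambda>(x, l). (Kl E F1 F2 l x, m (x, l)))"

definition L1 ::
    "(real^4 \<Rightarrow> real) \<Rightarrow> (real^4 \<Rightarrow> real) \<Rightarrow> (real^4 \<Rightarrow> real) \<Rightarrow>
     ((real^4) \<times> real \<Rightarrow> real) \<Rightarrow> (real^4) \<times> real \<Rightarrow> (real^4) \<times> real" where
  "L1 E F1 F2 n = (\<lambda>(x, l). (Rl E F1 F2 l x, n (x, l)))"

definition dlam :: "(real^4) \<times> real" where
  "dlam = (0, 1)"

text \<open>Condition (L) over \<open>U\<close>, for all values of the parameter.  As \<open>L0\<close> and \<open>L1\<close> are everywhere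
  linearly independent, membership in the span over the functions is pointwise membership.\<close>

definition cond_L ::
    "(real^4) set \<Rightarrow> (real^4 \<Rightarrow> real) \<Rightarrow> (real^4 \<Rightarrow> real) \<Rightarrow> (real^4 \<Rightarrow> real) \<Rightarrow>
     ((real^4) \<times> real \<Rightarrow> real) \<Rightarrow> ((real^4) \<times> real \<Rightarrow> real) \<Rightarrow> bool" where
  "cond_L U E F1 F2 m n \<longleftrightarrow>
     (\<forall>p \<in> U \<times> UNIV. lie_bracket (L0 E F1 F2 m) (L1 E F1 F2 n) p
        \<in> span {L0 E F1 F2 m p, L1 E F1 F2 n p})"

definition cond_L_mod_dlam ::
    "(real^4) set \<Rightarrow> (real^4 \<Rightarrow> real) \<Rightarrow> (real^4 \<Rightarrow> real) \<Rightarrow> (real^4 \<Rightarrow> real) \<Rightarrow>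
     ((real^4) \<times> real \<Rightarrow> real) \<Rightarrow> ((real^4) \<times> real \<Rightarrow> real) \<Rightarrow> bool" where
  "cond_L_mod_dlam U E F1 F2 m n \<longleftrightarrow>
     (\<forall>p \<in> U \<times> UNIV. lie_bracket (L0 E F1 F2 m) (L1 E F1 F2 n) p
        \<in> span {L0 E F1 F2 m p, L1 E F1 F2 n p, dlam})"

definition mn_form ::
    "(real^4) set \<Rightarrow> (real^4 \<Rightarrow> real) \<Rightarrow> (real^4 \<Rightarrow> real) \<Rightarrow> (real^4 \<Rightarrow> real) \<Rightarrow>
     ((real^4) \<times> real \<Rightarrow> real) \<Rightarrow> ((real^4) \<times> real \<Rightarrow> real) \<Rightarrow> bool" where
  "mn_form U E F1 F2 m n \<longleftrightarrow> (\<forall>x\<in>U. \<forall>l.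
     m (x, l) = 1/3 * l^3 * psi E F1 F2 l x + l^2 * phi E F1 F2 l x \<and>
     n (x, l) = - (l^2 / 3) * (m (x, l) + 3 * eta E F1 F2 l x + l * xi E F1 F2 l x))"

text \<open>Points of the jet space of the three unknown functions are given by one real coordinate for
  each unknown and each multi-index.  The coordinates are those of infinite jets; only finitely
  many of them enter a given differential polynomial.\<close>

datatype unknown = Unk_E | Unk_F1 | Unk_F2

type_synonym multi_index = "4 \<Rightarrow> nat"

type_synonym jet = "unknown \<Rightarrow> multi_index \<Rightarrow> real"

definition mi_order :: "multi_index \<Rightarrow> nat" where
  "mi_order \<alpha> = (\<Sum>i\<in>UNIV. \<alpha> i)"

definition pd :: "4 \<Rightarrow> (real^4 \<Rightarrow> real) \<Rightarrow> real^4 \<Rightarrow> real" where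
  "pd i f = vact (\<lambda>x. dd i) f"

definition mixed_pd :: "multi_index \<Rightarrow> (real^4 \<Rightarrow> real) \<Rightarrow> real^4 \<Rightarrow> real" where
  "mixed_pd \<alpha> f = (pd 0 ^^ \<alpha> 0) ((pd 1 ^^ \<alpha> 1) ((pd 2 ^^ \<alpha> 2) ((pd 3 ^^ \<alpha> 3) f)))"

definition jet_of ::
    "(real^4 \<Rightarrow> real) \<Rightarrow> (real^4 \<Rightarrow> real) \<Rightarrow> (real^4 \<Rightarrow> real) \<Rightarrow> real^4 \<Rightarrow> jet" where
  "jet_of E F1 F2 x = (\<lambda>u \<alpha>. mixed_pd \<alpha> (case u of Unk_E \<Rightarrow> E | Unk_F1 \<Rightarrow> F1 | Unk_F2 \<Rightarrow> F2) x)"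

inductive diff_poly :: "(jet \<Rightarrow> real) \<Rightarrow> bool" where
  const: "diff_poly (\<lambda>j. c)"
| coord: "diff_poly (\<lambda>j. j u \<alpha>)"
| add: "diff_poly f \<Longrightarrow> diff_poly g \<Longrightarrow> diff_poly (\<lambda>j. f j + g j)"
| mult: "diff_poly f \<Longrightarrow> diff_poly g \<Longrightarrow> diff_poly (\<lambda>j. f j * g j)"

definition order_le :: "unknown \<Rightarrow> nat \<Rightarrow> (jet \<Rightarrow> real) \<Rightarrow> bool" where
  "order_le u k f \<longleftrightarrow>
     (\<forall>j j'. (\<forall>v \<alpha>. v \<noteq> u \<or> mi_order \<alpha> \<le> k \<longrightarrow> j v \<alpha> = j' v \<alpha>) \<longrightarrow> f j = f j')"

definition has_order :: "unknown \<Rightarrow> nat \<Rightarrow> (jet \<Rightarrow> real) \<Rightarrow> bool" where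
  "has_order u k f \<longleftrightarrow> order_le u k f \<and> (\<forall>k'<k. \<not> order_le u k' f)"

end

theory Submission
  imports Defs
begin

text \<open>Modulo \<open>\<partial>\<^sub>\<lambda>\<close>, condition (L) is a linear system for the coefficients of \<open>[L\<^sub>0,L\<^sub>1] = a L\<^sub>0 + b L\<^sub>1\<close>;
  eliminating \<open>a\<close> and \<open>b\<close> from its four components yields the formulas for \<open>m\<close> and \<open>n\<close>.  Since
  \<open>[R\<^sub>1,K\<^sub>1] = R\<^sub>1(E) R\<^sub>1\<close>, the constant terms in \<open>\<lambda>\<close> of \<open>\<phi>\<close> and \<open>\<eta>\<close> vanish, so \<open>m\<close> and \<open>n\<close> are
  polynomials in \<open>\<lambda>\<close> with lowest term \<open>\<lambda>\<^sup>3\<close> and of degrees 4 and 6.  The remaining component equals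
  \<open>K\<^sub>\<lambda>(n) - R\<^sub>\<lambda>(m) + m \<partial>\<^sub>\<lambda>n - n \<partial>\<^sub>\<lambda>m + n \<xi>\<close>, in which exactly the powers \<open>\<lambda>\<^sup>3, ..., \<lambda>\<^sup>9\<close> occur;
  their coefficients are the seven differential polynomials.  Orders and linear independence are
  read off by evaluating these at jets with few nonzero coordinates.\<close>

section \<open>Smooth functions\<close>

text \<open>Agreement on an open set is agreement near each of its points, so the derivatives agree
  there as well and the induction applies to them.\<close>

lemma higher_diff_on_cong:
  assumes "open S" "\<And>x. x \<in> S \<Longrightarrow> f x = g x"
  shows "higher_diff_on k S f \<longleftrightarrow> higher_diff_on k S g"
  using assms(2)
proof (induction k arbitrary: f g)
  case 0
  then show ?case by (simp cong: continuous_on_cong)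
next
  case (Suc k)
  have imp: "higher_diff_on (Suc k) S g"
    if eq: "\<And>x. x \<in> S \<Longrightarrow> f x = g x" and f: "higher_diff_on (Suc k) S f" for f g :: "'a \<Rightarrow> real"
  proof -
    have "(f has_derivative frechet_derivative f (at x)) (at x)" if "x \<in> S" for x
      using f that frechet_derivative_works by auto
    then have g: "(g has_derivative frechet_derivative f (at x)) (at x)" if "x \<in> S" for x
      using has_derivative_transform_within_open[OF _ assms(1) that] that eq by blast
    then have "frechet_derivative f (at x) v = frechet_derivative g (at x) v" if "x \<in> S" for x v
      using frechet_derivative_at that by metis
    then have "higher_diff_on k S (\<lambda>x. frechet_derivative g (at x) v)" for v
      using f Suc.IH[of "\<lambda>x. frechet_derivative f (at x) v" "\<lambda>x. frechet_derivative g (at x) v"]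
      by simp
    with g show ?thesis
      unfolding higher_diff_on.simps differentiable_def by blast
  qed
  from imp[of f g] imp[of g f] Suc.prems show ?case by metis
qed

lemma smooth_on_cong:
  assumes "open S" "\<And>x. x \<in> S \<Longrightarrow> f x = g x"
  shows "smooth_on S f \<longleftrightarrow> smooth_on S g"
  unfolding smooth_on_def using higher_diff_on_cong[of S f g] assms by blast

lemma smooth_on_differentiable:
  "smooth_on S f \<Longrightarrow> x \<in> S \<Longrightarrow> f differentiable (at x)"
  unfolding smooth_on_def using higher_diff_on.simps(2) by blast

lemma smooth_on_has_derivative:
  "smooth_on S f \<Longrightarrow> x \<in> S \<Longrightarrow> (f has_derivative frechet_derivative f (at x)) (at x)"
  using smooth_on_differentiable frechet_derivative_works by blast

lemma smooth_on_frechet_derivative: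
  "smooth_on S f \<Longrightarrow> smooth_on S (\<lambda>x. frechet_derivative f (at x) v)"
  unfolding smooth_on_def using higher_diff_on.simps(2) by blast

lemma smooth_on_continuous_on: "smooth_on S f \<Longrightarrow> continuous_on S f"
  unfolding smooth_on_def using higher_diff_on.simps(1) by blast

text \<open>Uniqueness of the derivative lets any family \<open>f'\<close> stand in for
  \<open>frechet_derivative\<close>, so that the usual derivative rules can supply it.\<close>

lemma higher_diff_on_SucI:
  assumes "open S" "\<And>x. x \<in> S \<Longrightarrow> (f has_derivative f' x) (at x)"
    "\<And>v. higher_diff_on k S (\<lambda>x. f' x v)"
  shows "higher_diff_on (Suc k) S f"
proof -
  have "frechet_derivative f (at x) = f' x" if "x \<in> S" for x
    using assms(2)[OF that] frechet_derivative_at by metis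
  then have "higher_diff_on k S (\<lambda>x. frechet_derivative f (at x) v)" for v
    using higher_diff_on_cong[of S "\<lambda>x. f' x v" "\<lambda>x. frechet_derivative f (at x) v" k] assms(1,3) by simp
  with assms(2) show ?thesis
    unfolding higher_diff_on.simps differentiable_def by blast
qed

lemma higher_diff_on_const: "higher_diff_on k S (\<lambda>x. c)"
  by (induction k arbitrary: c) simp_all

lemma smooth_on_const: "smooth_on S (\<lambda>x. c)"
  by (simp add: smooth_on_def higher_diff_on_const)

lemma higher_diff_on_add:
  assumes "open S" "higher_diff_on k S f" "higher_diff_on k S g"
  shows "higher_diff_on k S (\<lambda>x. f x + g x)"
  using assms(2,3)
proof (induction k arbitrary: f g)
  case 0
  then show ?case by (simp add: continuous_on_add)
next
  case (Suc k)
  show ?case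
  proof (rule higher_diff_on_SucI[OF assms(1)])
    fix x assume "x \<in> S"
    with Suc.prems show "((\<lambda>x. f x + g x) has_derivative
        (\<lambda>v. frechet_derivative f (at x) v + frechet_derivative g (at x) v)) (at x)"
      by (intro has_derivative_add) (simp_all flip: frechet_derivative_works)
  qed (use Suc in simp)
qed

lemma smooth_on_add:
  "open S \<Longrightarrow> smooth_on S f \<Longrightarrow> smooth_on S g \<Longrightarrow> smooth_on S (\<lambda>x. f x + g x)"
  by (simp add: smooth_on_def higher_diff_on_add)

text \<open>The induction on \<open>k\<close> keeps full smoothness of both factors as its
  hypothesis: the product rule pairs an undifferentiated factor with a differentiated one, and both
  are again smooth.\<close>

lemma smooth_on_mult:
  assumes "open S" "smooth_on S f" "smooth_on S g"
  shows "smooth_on S (\<lambda>x. f x * g x)"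
proof -
  have "higher_diff_on k S (\<lambda>x. f x * g x)" for k
    using assms(2,3)
  proof (induction k arbitrary: f g)
    case 0
    then show ?case
      by (simp add: continuous_on_mult smooth_on_continuous_on)
  next
    case (Suc k)
    show ?case
      by (rule higher_diff_on_SucI[OF assms(1) has_derivative_mult[OF
            smooth_on_has_derivative[OF Suc.prems(1)] smooth_on_has_derivative[OF Suc.prems(2)]]])
        (assumption | intro higher_diff_on_add[OF assms(1)] Suc smooth_on_frechet_derivative)+
  qed
  then show ?thesis by (simp add: smooth_on_def)
qed

lemma smooth_on_power: "open S \<Longrightarrow> smooth_on S f \<Longrightarrow> smooth_on S (\<lambda>x. f x ^ n)"
  by (induction n) (simp_all add: smooth_on_const smooth_on_mult)

lemma smooth_on_snd:
  assumes "open S"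
  shows "smooth_on S (snd :: 'a::euclidean_space \<times> real \<Rightarrow> real)"
proof -
  have "higher_diff_on k S (snd :: 'a \<times> real \<Rightarrow> real)" for k
  proof (cases k)
    case (Suc j)
    have "((snd :: 'a \<times> real \<Rightarrow> real) has_derivative snd) (at x)" for x
      by (rule bounded_linear.has_derivative[OF bounded_linear_snd]) simp
    then show ?thesis unfolding Suc
      by (rule higher_diff_on_SucI[OF assms]) (rule higher_diff_on_const)
  qed (simp add: continuous_on_snd)
  then show ?thesis by (simp add: smooth_on_def)
qed

lemma smooth_on_compose_fst:
  assumes "open U" "smooth_on U f"
  shows "smooth_on (U \<times> (UNIV :: 'b::euclidean_space set)) (\<lambda>p. f (fst p))"
proof -
  have "higher_diff_on k (U \<times> (UNIV :: 'b set)) (\<lambda>p. f (fst p))" for k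
    using assms(2)
  proof (induction k arbitrary: f)
    case 0
    then show ?case
      by (auto intro!: continuous_on_compose2[OF smooth_on_continuous_on[OF 0]] continuous_intros)
  next
    case (Suc k)
    have "((\<lambda>p. f (fst p)) has_derivative (\<lambda>w. frechet_derivative f (at (fst p)) (fst w))) (at p)"
      if "p \<in> U \<times> (UNIV :: 'b set)" for p
      using that by (intro has_derivative_compose[OF bounded_linear.has_derivative[OF bounded_linear_fst]]
          smooth_on_has_derivative[OF Suc.prems]) auto
    then show ?case
      by (rule higher_diff_on_SucI[OF open_Times[OF assms(1) open_UNIV]])
        (assumption | intro Suc smooth_on_frechet_derivative)+
  qed
  then show ?thesis by (simp add: smooth_on_def)
qed

section \<open>Symmetry of second derivatives\<close>

text \<open>The second difference is the increment in \<open>s\<close> of a first difference in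
  direction \<open>w\<close>. The mean value theorem in \<open>s\<close> produces the derivative
  along \<open>v\<close>; a second application in \<open>t\<close>, with that \<open>s\<close>
  fixed, produces the mixed derivative.\<close>

lemma second_difference_mean_value:
  fixes f :: "'a::euclidean_space \<Rightarrow> real"
  assumes f: "smooth_on U f" and h: "h > 0"
    and U: "\<And>s t. 0 \<le> s \<Longrightarrow> s \<le> h \<Longrightarrow> 0 \<le> t \<Longrightarrow> t \<le> h \<Longrightarrow> x + s *\<^sub>R v + t *\<^sub>R w \<in> U"
  obtains s t where "0 \<le> s" "s \<le> h" "0 \<le> t" "t \<le> h"
    "f (x + h *\<^sub>R v + h *\<^sub>R w) - f (x + h *\<^sub>R v) - f (x + h *\<^sub>R w) + f x =
       h * h * frechet_derivative (\<lambda>y. frechet_derivative f (at y) v) (at (x + s *\<^sub>R v + t *\<^sub>R w)) w"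
proof -
  let ?f' = "\<lambda>y. frechet_derivative f (at y)"
  let ?g = "\<lambda>y. frechet_derivative f (at y) v"
  let ?g' = "\<lambda>y. frechet_derivative ?g (at y)"
  \<comment> \<open>The summand \<open>0 *\<^sub>R w\<close> is kept so that both terms are the same
    expression at \<open>t = h\<close> and \<open>t = 0\<close>, with derivatives given by one
    fact.\<close>
  let ?\<phi> = "\<lambda>s. f (x + s *\<^sub>R v + h *\<^sub>R w) - f (x + s *\<^sub>R v + 0 *\<^sub>R w)"
  have f': "((\<lambda>s. f (x + s *\<^sub>R v + t *\<^sub>R w)) has_derivative (\<lambda>r. ?f' (x + s *\<^sub>R v + t *\<^sub>R w) (r *\<^sub>R v))) (at s)"
    if "0 \<le> s" "s \<le> h" "0 \<le> t" "t \<le> h" for s t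
    by (rule has_derivative_compose[OF _ smooth_on_has_derivative[OF f], of "\<lambda>s. x + s *\<^sub>R v + t *\<^sub>R w"])
      (use U that in \<open>auto intro!: derivative_eq_intros\<close>)
  have lin: "?f' y (r *\<^sub>R v) = r * ?g y" if "y \<in> U" for y r
    using linear_scale[OF has_derivative_linear[OF smooth_on_has_derivative[OF f that]]] by simp
  have \<phi>': "(?\<phi> has_derivative (\<lambda>r. ?f' (x + s *\<^sub>R v + h *\<^sub>R w) (r *\<^sub>R v) - ?f' (x + s *\<^sub>R v + 0 *\<^sub>R w) (r *\<^sub>R v))) (at s)"
    if "0 \<le> s" "s \<le> h" for s
    by (intro has_derivative_diff f') (use that h in auto)
  have cont1: "continuous_on {0..h} ?\<phi>"
    by (intro continuous_at_imp_continuous_on ballI has_derivative_continuous[OF \<phi>']) simp_all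
  obtain s where s: "0 < s" "s < h"
    "?\<phi> h - ?\<phi> 0 = ?f' (x + s *\<^sub>R v + h *\<^sub>R w) ((h - 0) *\<^sub>R v) - ?f' (x + s *\<^sub>R v + 0 *\<^sub>R w) ((h - 0) *\<^sub>R v)"
    by (rule mvt[OF h cont1 \<phi>'])
      (simp_all only: less_imp_le)
  have g': "((\<lambda>t. ?g (x + s *\<^sub>R v + t *\<^sub>R w)) has_derivative (\<lambda>r. ?g' (x + s *\<^sub>R v + t *\<^sub>R w) (r *\<^sub>R w))) (at t)"
    if "0 \<le> t" "t \<le> h" for t
    by (rule has_derivative_compose[OF _ smooth_on_has_derivative[OF smooth_on_frechet_derivative[OF f]],
          of "\<lambda>t. x + s *\<^sub>R v + t *\<^sub>R w"])
      (use U that s in \<open>auto intro!: derivative_eq_intros\<close>)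
  have cont2: "continuous_on {0..h} (\<lambda>t. ?g (x + s *\<^sub>R v + t *\<^sub>R w))"
    by (intro continuous_at_imp_continuous_on ballI has_derivative_continuous[OF g']) simp_all
  obtain t where t: "0 < t" "t < h"
    "?g (x + s *\<^sub>R v + h *\<^sub>R w) - ?g (x + s *\<^sub>R v + 0 *\<^sub>R w) = ?g' (x + s *\<^sub>R v + t *\<^sub>R w) ((h - 0) *\<^sub>R w)"
    by (rule mvt[OF h cont2 g'])
      (simp_all only: less_imp_le)
  have st: "x + s *\<^sub>R v + t *\<^sub>R w \<in> U" "x + s *\<^sub>R v + h *\<^sub>R w \<in> U" "x + s *\<^sub>R v + 0 *\<^sub>R w \<in> U"
    by (rule U; use s t h in simp)+
  have "?g' (x + s *\<^sub>R v + t *\<^sub>R w) (h *\<^sub>R w) = h * ?g' (x + s *\<^sub>R v + t *\<^sub>R w) w"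
    using linear_scale[OF has_derivative_linear[OF smooth_on_has_derivative[OF smooth_on_frechet_derivative[OF f] st(1)]]]
    by simp
  with s t have "?\<phi> h - ?\<phi> 0 = h * (h * ?g' (x + s *\<^sub>R v + t *\<^sub>R w) w)"
    using lin[OF st(2)] lin[OF st(3)] by (simp flip: right_diff_distrib)
  then show ?thesis
    using that[of s t] s t by simp
qed

text \<open>The second difference is symmetric in \<open>v\<close> and \<open>w\<close>, so applying
  the mean value theorem in either order gives the same number. On a small parallelogram, continuity
  puts both mixed derivatives within \<open>e/2\<close> of their values at \<open>x\<close>.\<close>

lemma frechet_derivative_commute:
  fixes f :: "'a::euclidean_space \<Rightarrow> real"
  assumes U: "open U" and f: "smooth_on U f" and x: "x \<in> U"
  shows "frechet_derivative (\<lambda>y. frechet_derivative f (at y) v) (at x) w =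
         frechet_derivative (\<lambda>y. frechet_derivative f (at y) w) (at x) v"
proof -
  let ?A = "\<lambda>v w y. frechet_derivative (\<lambda>y. frechet_derivative f (at y) v) (at y) w"
  have cont: "isCont (?A v w) x" for v w
    using smooth_on_continuous_on[OF smooth_on_frechet_derivative[OF smooth_on_frechet_derivative[OF f]]]
      continuous_on_eq_continuous_at[OF U] x by blast
  have "\<bar>?A v w x - ?A w v x\<bar> < e" if e: "e > 0" for e
  proof -
    obtain d1 where d1: "d1 > 0" "\<And>y. dist y x < d1 \<Longrightarrow> \<bar>?A v w y - ?A v w x\<bar> < e/2"
      using cont[of v w] e unfolding continuous_at_eps_delta dist_real_def by (metis half_gt_zero)
    obtain d2 where d2: "d2 > 0" "\<And>y. dist y x < d2 \<Longrightarrow> \<bar>?A w v y - ?A w v x\<bar> < e/2"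
      using cont[of w v] e unfolding continuous_at_eps_delta dist_real_def by (metis half_gt_zero)
    obtain d3 where d3: "d3 > 0" "\<And>y. dist y x < d3 \<Longrightarrow> y \<in> U"
      using U x unfolding open_dist by blast
    define d where "d = min d1 (min d2 d3)"
    \<comment> \<open>Keeps the whole parallelogram within \<open>d/2\<close> of \<open>x\<close>;
      the summand 1 makes the denominator positive even for \<open>v = w = 0\<close>.\<close>
    define h where "h = d / (2 * (norm v + norm w + 1))"
    have "d > 0" using d1 d2 d3 by (simp add: d_def)
    have pos: "norm v + norm w + 1 > 0"
      by (smt (verit) norm_ge_zero)
    have h: "h > 0" using \<open>d > 0\<close> pos by (simp add: h_def)
    have close: "dist (x + s *\<^sub>R v + t *\<^sub>R w) x < d" if "0 \<le> s" "s \<le> h" "0 \<le> t" "t \<le> h" for s t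
    proof -
      have "dist (x + s *\<^sub>R v + t *\<^sub>R w) x \<le> norm (s *\<^sub>R v) + norm (t *\<^sub>R w)"
        using norm_triangle_ineq[of "s *\<^sub>R v" "t *\<^sub>R w"] by (simp add: dist_norm add.assoc)
      also have "\<dots> \<le> h * norm v + h * norm w"
        using that by (intro add_mono) (simp_all add: mult_right_mono)
      also have "\<dots> \<le> h * (norm v + norm w + 1)"
        using h by (simp add: algebra_simps)
      also have "\<dots> = d / 2"
        using pos by (simp add: h_def divide_simps)
      also have "\<dots> < d" using \<open>d > 0\<close> by simp
      finally show ?thesis .
    qed
    obtain s t where st: "0 \<le> s" "s \<le> h" "0 \<le> t" "t \<le> h"
      "f (x + h *\<^sub>R v + h *\<^sub>R w) - f (x + h *\<^sub>R v) - f (x + h *\<^sub>R w) + f x = h * h * ?A v w (x + s *\<^sub>R v + t *\<^sub>R w)"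
      by (rule second_difference_mean_value[OF f h, of x v w]) (use close d3 in \<open>auto simp: d_def\<close>)
    obtain s' t' where st': "0 \<le> s'" "s' \<le> h" "0 \<le> t'" "t' \<le> h"
      "f (x + h *\<^sub>R w + h *\<^sub>R v) - f (x + h *\<^sub>R w) - f (x + h *\<^sub>R v) + f x = h * h * ?A w v (x + s' *\<^sub>R w + t' *\<^sub>R v)"
    proof (rule second_difference_mean_value[OF f h, of x w v])
      fix s t assume "0 \<le> s" "s \<le> h" "0 \<le> t" "t \<le> h"
      then show "x + s *\<^sub>R w + t *\<^sub>R v \<in> U"
        using close[of t s] d3 by (auto simp: d_def algebra_simps)
    qed blast
    have "h * h * ?A v w (x + s *\<^sub>R v + t *\<^sub>R w) = h * h * ?A w v (x + s' *\<^sub>R w + t' *\<^sub>R v)"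
      unfolding st(5)[symmetric] st'(5)[symmetric] by (simp add: algebra_simps)
    then have "?A v w (x + s *\<^sub>R v + t *\<^sub>R w) = ?A w v (x + s' *\<^sub>R w + t' *\<^sub>R v)"
      using h by simp
    moreover have "\<bar>?A v w (x + s *\<^sub>R v + t *\<^sub>R w) - ?A v w x\<bar> < e/2"
      using close[OF st(1-4)] by (intro d1) (simp add: d_def)
    moreover have "\<bar>?A w v (x + s' *\<^sub>R w + t' *\<^sub>R v) - ?A w v x\<bar> < e/2"
      using close[OF st'(3,4) st'(1,2)] by (intro d2) (simp add: d_def algebra_simps)
    ultimately show ?thesis by linarith
  qed
  then show ?thesis
    by (metis less_irrefl right_minus_eq zero_less_abs_iff)
qed

section \<open>Differential polynomials\<close>

text \<open>The library enumerates the index type as 1, 2, 3, 4; its 4 is the coordinate index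
  0.\<close>

lemma four_eq_zero: "(4 :: 4) = 0"
  by simp

lemma all_4_iff: "(\<forall>i::4. P i) \<longleftrightarrow> P 0 \<and> P 1 \<and> P 2 \<and> P 3"
  unfolding forall_4 four_eq_zero by blast

lemma sum_UNIV_4: "(\<Sum>i\<in>(UNIV :: 4 set). f i) = f 0 + f 1 + f 2 + f 3"
  unfolding sum_4 four_eq_zero by (simp add: ac_simps)

section \<open>Syntax trees for differential polynomials\<close>

text \<open>\<open>diff_poly\<close> is a predicate on functions; on syntax trees total derivatives
  and order bounds can be defined by recursion.\<close>

datatype dpoly =
  DConst real
| DCoord unknown multi_index
| DAdd dpoly dpoly (infixl "\<oplus>\<^sub>d" 65)
| DMult dpoly dpoly (infixl "\<otimes>\<^sub>d" 70)

primrec deval :: "dpoly \<Rightarrow> jet \<Rightarrow> real" where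
  "deval (DConst c) j = c"
| "deval (DCoord u \<alpha>) j = j u \<alpha>"
| "deval (p \<oplus>\<^sub>d q) j = deval p j + deval q j"
| "deval (p \<otimes>\<^sub>d q) j = deval p j * deval q j"

primrec total_deriv :: "4 \<Rightarrow> dpoly \<Rightarrow> dpoly" where
  "total_deriv i (DConst c) = DConst 0"
| "total_deriv i (DCoord u \<alpha>) = DCoord u (\<alpha>(i := Suc (\<alpha> i)))"
| "total_deriv i (p \<oplus>\<^sub>d q) = total_deriv i p \<oplus>\<^sub>d total_deriv i q"
| "total_deriv i (p \<otimes>\<^sub>d q) = total_deriv i p \<otimes>\<^sub>d q \<oplus>\<^sub>d p \<otimes>\<^sub>d total_deriv i q"

text \<open>A syntactic upper bound: cancellation is not seen, so it yields only
  \<open>order_le\<close>. Exact orders come from evaluation at special jets.\<close>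

primrec dord :: "unknown \<Rightarrow> dpoly \<Rightarrow> nat" where
  "dord u (DConst c) = 0"
| "dord u (DCoord v \<alpha>) = (if u = v then mi_order \<alpha> else 0)"
| "dord u (p \<oplus>\<^sub>d q) = max (dord u p) (dord u q)"
| "dord u (p \<otimes>\<^sub>d q) = max (dord u p) (dord u q)"

lemma deval_eta:
  "deval (DConst c) = (\<lambda>j. c)" "deval (DCoord u \<alpha>) = (\<lambda>j. j u \<alpha>)"
  "deval (p \<oplus>\<^sub>d q) = (\<lambda>j. deval p j + deval q j)"
  "deval (p \<otimes>\<^sub>d q) = (\<lambda>j. deval p j * deval q j)"
  by (simp_all add: fun_eq_iff)

lemma diff_poly_deval: "diff_poly (deval p)"
  by (induction p) (simp_all only: deval_eta diff_poly.intros)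

lemma order_le_deval:
  assumes "dord u p \<le> k"
  shows "order_le u k (deval p)"
  unfolding order_le_def
proof (intro allI impI)
  fix j j' :: jet
  assume "\<forall>v \<alpha>. v \<noteq> u \<or> mi_order \<alpha> \<le> k \<longrightarrow> j v \<alpha> = j' v \<alpha>"
  with assms show "deval p j = deval p j'"
    by (induction p) (auto split: if_splits)
qed

lemma mi_order_upd_Suc: "mi_order (\<alpha>(i := Suc (\<alpha> i))) = Suc (mi_order \<alpha>)"
proof -
  have "mi_order (\<alpha>(i := Suc (\<alpha> i))) = Suc (\<alpha> i) + (\<Sum>k\<in>UNIV - {i}. \<alpha> k)"
    unfolding mi_order_def by (subst sum.remove[of _ i]) auto
  also have "\<dots> = Suc (mi_order \<alpha>)"
    unfolding mi_order_def by (subst (2) sum.remove[of _ i]) auto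
  finally show ?thesis .
qed

lemma dord_total_deriv: "dord u (total_deriv i p) \<le> Suc (dord u p)"
  by (induction p) (auto simp: mi_order_upd_Suc)

abbreviation dscale :: "real \<Rightarrow> dpoly \<Rightarrow> dpoly" (infixr "\<cdot>\<^sub>d" 75) where
  "c \<cdot>\<^sub>d p \<equiv> DConst c \<otimes>\<^sub>d p"

abbreviation dminus :: "dpoly \<Rightarrow> dpoly \<Rightarrow> dpoly" (infixl "\<ominus>\<^sub>d" 65) where
  "p \<ominus>\<^sub>d q \<equiv> p \<oplus>\<^sub>d (-1) \<cdot>\<^sub>d q"

definition unk :: "unknown \<Rightarrow> dpoly" where
  "unk u = DCoord u (\<lambda>_. 0)"

abbreviation "dE \<equiv> unk Unk_E"

text \<open>Symbolic versions of the objects of the statement.  A final digit \<open>k\<close> in \<open>dxi\<close>, \<open>deta\<close>, \<open>dphi\<close>,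
  \<open>dm\<close>, \<open>dn\<close> denotes the coefficient of \<open>\<lambda>\<^sup>k\<close>, whereas \<open>dPhik\<close> is the coefficient of \<open>\<lambda>\<close> to the
  power \<open>k + 3\<close> in the obstruction.\<close>

definition "dK1 p = total_deriv 1 p \<oplus>\<^sub>d dE \<otimes>\<^sub>d total_deriv 3 p"
definition "dR1 p = total_deriv 3 p"

definition "dP = dK1 (unk Unk_F1)"
definition "dQ = dK1 (unk Unk_F2)"
definition "dS = dR1 (unk Unk_F1)"
definition "dT = dR1 (unk Unk_F2)"

definition "dK2 p = total_deriv 0 p \<oplus>\<^sub>d dE \<otimes>\<^sub>d total_deriv 2 p \<oplus>\<^sub>d dP \<otimes>\<^sub>d total_deriv 3 p
   \<oplus>\<^sub>d dQ \<otimes>\<^sub>d total_deriv 1 p"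
definition "dR2 p = total_deriv 2 p \<oplus>\<^sub>d dS \<otimes>\<^sub>d total_deriv 3 p \<oplus>\<^sub>d dT \<otimes>\<^sub>d total_deriv 1 p"

definition "dxi0 = dR1 dE"
definition "dxi1 = dR2 dE"
definition "dxi2 = (1/3) \<cdot>\<^sub>d dK1 dE"
definition "deta1 = dK2 dT \<ominus>\<^sub>d dR2 dQ \<oplus>\<^sub>d dT \<otimes>\<^sub>d dxi1"
definition "deta2 = (-1/3) \<cdot>\<^sub>d dK1 dQ \<oplus>\<^sub>d dT \<otimes>\<^sub>d dxi2"
definition "dphi1 = dK2 dS \<ominus>\<^sub>d dR2 dP \<oplus>\<^sub>d dS \<otimes>\<^sub>d dxi1 \<ominus>\<^sub>d dE \<otimes>\<^sub>d deta1"
definition "dphi2 = (-1/3) \<cdot>\<^sub>d dK1 dP \<oplus>\<^sub>d dS \<otimes>\<^sub>d dxi2 \<ominus>\<^sub>d dE \<otimes>\<^sub>d deta2"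

definition "dm3 = (1/3) \<cdot>\<^sub>d dK1 dE \<oplus>\<^sub>d dphi1"
definition "dm4 = (1/3) \<cdot>\<^sub>d dK2 dE \<oplus>\<^sub>d dphi2"
definition "dn3 = (-1) \<cdot>\<^sub>d deta1 \<oplus>\<^sub>d (-1/3) \<cdot>\<^sub>d dxi0"
definition "dn4 = (-1) \<cdot>\<^sub>d deta2 \<oplus>\<^sub>d (-1/3) \<cdot>\<^sub>d dxi1"
definition "dn5 = (-1/3) \<cdot>\<^sub>d (dm3 \<oplus>\<^sub>d dxi2)"
definition "dn6 = (-1/3) \<cdot>\<^sub>d dm4"

text \<open>Powers of \<lambda> collected in \<open>K\<^sub>\<lambda>(n) - R\<^sub>\<lambda>(m) + m
  \<partial>\<^sub>\<lambda>n - n \<partial>\<^sub>\<lambda>m + n \<xi>\<close>. The coefficients of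
  \<open>\<lambda>^i\<close> in \<open>m\<close> and of \<open>\<lambda>^j\<close> in
  \<open>n\<close> contribute their product with factor \<open>j - i\<close> at
  \<open>\<lambda>^(i + j - 1)\<close>; hence the integer factors and the absence of the products of
  \<open>dm3\<close> with \<open>dn3\<close> and of \<open>dm4\<close> with \<open>dn4\<close>. The
  terms \<open>-1/3\<close> times \<open>dK1 dm3\<close> and \<open>dK1 dm4\<close> stem from the
  quadratic part of \<open>R\<^sub>\<lambda>\<close>.\<close>

definition "dPhi0 = dK1 dn3 \<ominus>\<^sub>d dR1 dm3 \<oplus>\<^sub>d dn3 \<otimes>\<^sub>d dxi0"
definition "dPhi1 = dK1 dn4 \<oplus>\<^sub>d dK2 dn3 \<ominus>\<^sub>d dR1 dm4 \<ominus>\<^sub>d dR2 dm3 \<oplus>\<^sub>d dn4 \<otimes>\<^sub>d dxi0 \<oplus>\<^sub>d dn3 \<otimes>\<^sub>d dxi1"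
definition "dPhi2 = dK1 dn5 \<oplus>\<^sub>d dK2 dn4 \<ominus>\<^sub>d dR2 dm4 \<oplus>\<^sub>d (-1/3) \<cdot>\<^sub>d dK1 dm3
       \<oplus>\<^sub>d dn5 \<otimes>\<^sub>d dxi0 \<oplus>\<^sub>d dn4 \<otimes>\<^sub>d dxi1 \<oplus>\<^sub>d dn3 \<otimes>\<^sub>d dxi2"
definition "dPhi3 = dK1 dn6 \<oplus>\<^sub>d dK2 dn5 \<oplus>\<^sub>d (-1/3) \<cdot>\<^sub>d dK1 dm4
       \<oplus>\<^sub>d dn6 \<otimes>\<^sub>d dxi0 \<oplus>\<^sub>d dn5 \<otimes>\<^sub>d dxi1 \<oplus>\<^sub>d dn4 \<otimes>\<^sub>d dxi2 \<oplus>\<^sub>d dm3 \<otimes>\<^sub>d dn4 \<ominus>\<^sub>d dm4 \<otimes>\<^sub>d dn3"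
definition "dPhi4 = dK2 dn6 \<oplus>\<^sub>d dn6 \<otimes>\<^sub>d dxi1 \<oplus>\<^sub>d dn5 \<otimes>\<^sub>d dxi2 \<oplus>\<^sub>d 2 \<cdot>\<^sub>d dm3 \<otimes>\<^sub>d dn5"
definition "dPhi5 = dn6 \<otimes>\<^sub>d dxi2 \<oplus>\<^sub>d 3 \<cdot>\<^sub>d dm3 \<otimes>\<^sub>d dn6 \<oplus>\<^sub>d dm4 \<otimes>\<^sub>d dn5"
definition "dPhi6 = 2 \<cdot>\<^sub>d dm4 \<otimes>\<^sub>d dn6"

definition dPhi :: "nat \<Rightarrow> dpoly" where
  "dPhi i = [dPhi0, dPhi1, dPhi2, dPhi3, dPhi4, dPhi5, dPhi6] ! i"

lemmas dPhi_defs = dPhi0_def dPhi1_def dPhi2_def dPhi3_def dPhi4_def dPhi5_def dPhi6_def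

text \<open>Bounds the order in \<open>u\<close> of the coefficients of \<open>m\<close> and
  \<open>n\<close>; the obstruction differentiates these once more.\<close>

definition coeff_order :: "unknown \<Rightarrow> nat" where
  "coeff_order u = (if u = Unk_E then 1 else 2)"

section \<open>Upper bounds for the orders\<close>

lemma dord_unk [simp]: "dord u (unk v) = 0"
  by (simp add: unk_def mi_order_def)

lemma dord_K1: "dord u (dK1 p) \<le> Suc (dord u p)"
  using dord_total_deriv[of u 1 p] dord_total_deriv[of u 3 p] by (simp add: dK1_def)

lemma dord_R1: "dord u (dR1 p) \<le> Suc (dord u p)"
  using dord_total_deriv[of u 3 p] by (simp add: dR1_def)

text \<open>\<open>K1\<close> has \<open>E\<close> itself as a coefficient but no derivative of it.
  The resulting order 0 in \<open>E\<close> is what keeps the coefficients of \<open>m\<close> and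
  \<open>n\<close> at order 1 in \<open>E\<close>.\<close>

lemma dord_PQST:
  "dord u dP \<le> 1" "dord u dQ \<le> 1" "dord u dS \<le> 1" "dord u dT \<le> 1"
  "dord Unk_E dP = 0" "dord Unk_E dQ = 0" "dord Unk_E dS = 0" "dord Unk_E dT = 0"
  using dord_K1[of u "unk Unk_F1"] dord_K1[of u "unk Unk_F2"]
    dord_R1[of u "unk Unk_F1"] dord_R1[of u "unk Unk_F2"]
  unfolding dP_def dQ_def dS_def dT_def by simp_all (simp_all add: dK1_def dR1_def unk_def mi_order_def)

lemma dord_K2: "dord u (dK2 p) \<le> Suc (dord u p)"
  using dord_total_deriv[of u 0 p] dord_total_deriv[of u 1 p] dord_total_deriv[of u 2 p]
    dord_total_deriv[of u 3 p] dord_PQST(1,2)[of u] by (simp add: dK2_def)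

lemma dord_R2: "dord u (dR2 p) \<le> Suc (dord u p)"
  using dord_total_deriv[of u 1 p] dord_total_deriv[of u 2 p]
    dord_total_deriv[of u 3 p] dord_PQST(3,4)[of u] by (simp add: dR2_def)

lemmas dord_frame = dord_K1 dord_K2 dord_R1 dord_R2

lemma dord_frame_le:
  assumes "dord u p \<le> k"
  shows "dord u (dK1 p) \<le> Suc k" "dord u (dK2 p) \<le> Suc k"
    "dord u (dR1 p) \<le> Suc k" "dord u (dR2 p) \<le> Suc k"
  using assms dord_frame[of u p] by linarith+

lemma dord_coeffs:
  fixes u :: unknown
  defines "k \<equiv> coeff_order u"
  shows "dord u dm3 \<le> k" "dord u dm4 \<le> k" "dord u dn3 \<le> k"
  "dord u dn4 \<le> k" "dord u dn5 \<le> k" "dord u dn6 \<le> k"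
  "dord u dxi0 \<le> k" "dord u dxi1 \<le> k" "dord u dxi2 \<le> k"
proof -
  \<comment> \<open>\<open>k'\<close> bounds the order in \<open>u\<close> of \<open>P\<close>,
    \<open>Q\<close>, \<open>S\<close>, \<open>T\<close> and \<open>E\<close>: it is 0 for
    \<open>Unk_E\<close> and 1 otherwise. One application of a frame field then stays within
    \<open>k\<close>.\<close>
  define k' where "k' = k - 1"
  have k: "k = Suc k'" by (simp add: k'_def k_def coeff_order_def)
  have PQST: "dord u dP \<le> k'" "dord u dQ \<le> k'" "dord u dS \<le> k'" "dord u dT \<le> k'"
    using dord_PQST(1-4)[of u] dord_PQST(5-8) k by (auto simp: k_def coeff_order_def split: if_splits)
  note le = PQST[THEN le_SucI] dord_frame_le[OF PQST(1)] dord_frame_le[OF PQST(2)]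
    dord_frame_le[OF PQST(3)] dord_frame_le[OF PQST(4)] dord_frame_le[of u dE k']
  show xi: "dord u dxi0 \<le> k" "dord u dxi1 \<le> k" "dord u dxi2 \<le> k"
    by (simp_all add: le k dxi0_def dxi1_def dxi2_def)
  have eta: "dord u deta1 \<le> k" "dord u deta2 \<le> k"
    using xi by (simp_all add: le k deta1_def deta2_def)
  have phi: "dord u dphi1 \<le> k" "dord u dphi2 \<le> k"
    using xi eta by (simp_all add: le k dphi1_def dphi2_def)
  show m: "dord u dm3 \<le> k" "dord u dm4 \<le> k"
    using phi by (simp_all add: le k dm3_def dm4_def)
  show "dord u dn3 \<le> k" "dord u dn4 \<le> k" "dord u dn5 \<le> k" "dord u dn6 \<le> k"
    using m xi eta by (simp_all add: dn3_def dn4_def dn5_def dn6_def)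
qed

lemma dord_Phi:
  assumes "i < 7"
  shows "dord u (dPhi i) \<le> Suc (coeff_order u)"
proof -
  define k where "k = coeff_order u"
  note le = dord_coeffs[of u, folded k_def]
  have op: "dord u (p \<oplus>\<^sub>d q) \<le> Suc k" "dord u (p \<otimes>\<^sub>d q) \<le> Suc k"
    if "dord u p \<le> Suc k" "dord u q \<le> Suc k" for p q
    using that by simp_all
  have const: "dord u (DConst c) \<le> Suc k" for c
    by simp
  have "\<forall>p \<in> set [dPhi0, dPhi1, dPhi2, dPhi3, dPhi4, dPhi5, dPhi6]. dord u p \<le> Suc k"
    unfolding dPhi_defs list.set ball_simps
    by (intro conjI TrueI op const dord_frame_le le le[THEN le_SucI])
  moreover have "dPhi i \<in> set [dPhi0, dPhi1, dPhi2, dPhi3, dPhi4, dPhi5, dPhi6]"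
    unfolding dPhi_def by (rule nth_mem) (use assms in simp)
  ultimately show ?thesis unfolding k_def by blast
qed

section \<open>Exact orders and linear independence by evaluation at sparse jets\<close>

text \<open>A literal form of multi-indices on which the simplifier decides equality
  (\<open>mi_eq_iff\<close>) and computes total derivatives (\<open>total_deriv_mi\<close>).\<close>

definition mi :: "nat \<Rightarrow> nat \<Rightarrow> nat \<Rightarrow> nat \<Rightarrow> multi_index" where
  "mi a b c d = (\<lambda>i. if i = 0 then a else if i = 1 then b else if i = 2 then c else d)"

lemma mi_eq_iff: "mi a b c d = mi a' b' c' d' \<longleftrightarrow> a = a' \<and> b = b' \<and> c = c' \<and> d = d'"
proof
  assume *: "mi a b c d = mi a' b' c' d'"
  show "a = a' \<and> b = b' \<and> c = c' \<and> d = d'"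
    using fun_cong[OF *, of 0] fun_cong[OF *, of 1] fun_cong[OF *, of 2] fun_cong[OF *, of 3]
    by (simp add: mi_def)
qed simp

lemma unk_mi: "unk u = DCoord u (mi 0 0 0 0)"
  by (auto simp: unk_def mi_def fun_eq_iff)

lemma total_deriv_mi:
  "total_deriv 0 (DCoord u (mi a b c d)) = DCoord u (mi (Suc a) b c d)"
  "total_deriv 1 (DCoord u (mi a b c d)) = DCoord u (mi a (Suc b) c d)"
  "total_deriv 2 (DCoord u (mi a b c d)) = DCoord u (mi a b (Suc c) d)"
  "total_deriv 3 (DCoord u (mi a b c d)) = DCoord u (mi a b c (Suc d))"
proof -
  have "i = 3" if "i \<noteq> 0" "i \<noteq> 1" "i \<noteq> 2" for i :: 4
    using exhaust_4[of i] that by auto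
  then show "total_deriv 0 (DCoord u (mi a b c d)) = DCoord u (mi (Suc a) b c d)"
    "total_deriv 1 (DCoord u (mi a b c d)) = DCoord u (mi a (Suc b) c d)"
    "total_deriv 2 (DCoord u (mi a b c d)) = DCoord u (mi a b (Suc c) d)"
    "total_deriv 3 (DCoord u (mi a b c d)) = DCoord u (mi a b c (Suc d))"
    by (auto simp: mi_def fun_eq_iff)
qed

text \<open>The top-order coordinates are chosen such that the \<open>i\<close>-th parameter of each family occurs linearly
  in the \<open>i\<close>-th polynomial.  In the last two of the five, third derivatives of \<open>F\<^sup>2\<close> occur only multiplied
  by \<open>E\<close>, whence the second family.\<close>

definition probe_jet :: "(nat \<Rightarrow> real) \<Rightarrow> (nat \<Rightarrow> real) \<Rightarrow> (nat \<Rightarrow> real) \<Rightarrow> real \<Rightarrow> real \<Rightarrow> jet" where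
  "probe_jet a b c s r u \<alpha> = (case u of
     Unk_E \<Rightarrow>
       if \<alpha> = mi 0 1 0 1 then a 0 else if \<alpha> = mi 1 0 0 1 then a 1 else if \<alpha> = mi 1 0 1 0 then a 2 else
       if \<alpha> = mi 1 1 0 0 then a 3 else if \<alpha> = mi 2 0 0 0 then a 4 else if \<alpha> = mi 0 1 0 0 then s else 0
   | Unk_F1 \<Rightarrow>
       if \<alpha> = mi 1 0 0 2 then b 0 else if \<alpha> = mi 0 2 0 1 then b 1 else if \<alpha> = mi 0 2 1 0 then b 2 else
       if \<alpha> = mi 0 3 0 0 then b 3 else if \<alpha> = mi 1 2 0 0 then b 4 else if \<alpha> = mi 0 2 0 0 then r else 0
   | Unk_F2 \<Rightarrow>
       if \<alpha> = mi 1 1 0 1 then c 0 else if \<alpha> = mi 0 3 0 0 then c 1 else if \<alpha> = mi 1 2 0 0 then c 2 else 0)"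

definition probe_jet_F2 :: "(nat \<Rightarrow> real) \<Rightarrow> jet" where
  "probe_jet_F2 c u \<alpha> = (case u of
     Unk_E \<Rightarrow> of_bool (\<alpha> = mi 0 0 0 0)
   | Unk_F1 \<Rightarrow> 0
   | Unk_F2 \<Rightarrow> if \<alpha> = mi 0 3 0 0 then c 3 else if \<alpha> = mi 1 2 0 0 then c 4 else 0)"

text \<open>Together with \<open>deval_lazy_cong\<close>, the rules \<open>lazy_eval\<close> make the simplifier evaluate without first
  expanding the symbolic derivatives; \<open>mult_lazy_cong\<close> discards products with a vanishing factor.\<close>

lemmas symbolic_eqs = dPhi_defs dn6_def dn5_def dn4_def dn3_def dm4_def dm3_def dphi2_def dphi1_def
  deta2_def deta1_def dxi2_def dxi1_def dxi0_def dR2_def dK2_def dT_def dS_def dQ_def dP_def dR1_def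
  dK1_def unk_mi total_deriv.simps(1,3,4) total_deriv_mi

lemmas lazy_eval =
  symbolic_eqs[THEN arg_cong[where f = "\<lambda>p. deval p j" for j]]
  symbolic_eqs[THEN arg_cong[where f = "\<lambda>p. deval (total_deriv i p) j" for i j]]
  symbolic_eqs[THEN arg_cong[where f = "\<lambda>p. deval (total_deriv i (total_deriv k p)) j" for i k j]]
  unk_mi[THEN arg_cong[where f = "\<lambda>p. deval (total_deriv i (total_deriv k (total_deriv l p))) j" for i k l j]]

lemma deval_lazy_cong: "deval p j = deval p j" ..

lemma mult_lazy_cong: "a = a' \<Longrightarrow> (a' \<noteq> 0 \<Longrightarrow> b = b') \<Longrightarrow> a * b = a' * (b' :: real)"
  by (cases "a' = 0") auto

text \<open>\<open>dPhi5\<close> and \<open>dPhi6\<close> are built from undifferentiated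
  coefficients of \<open>m\<close>, \<open>n\<close> and \<open>\<xi>\<close>, so the top-order
  parameters \<open>a\<close>, \<open>b\<close>, \<open>c\<close> do not reach them. The values
  \<open>s\<close> of \<open>\<partial>\<^sub>1 E\<close> and \<open>r\<close> of
  \<open>\<partial>\<^sub>1\<^sup>2 F\<^sup>1\<close> keep them from vanishing.\<close>

lemma deval_probe_jet:
  "deval dPhi0 (probe_jet a b c s r) = - c 0 - 2/3 * a 0 - b 0"
  "deval dPhi1 (probe_jet a b c s r) = 1/3 * c 1 - 2/3 * a 1 + 1/3 * b 1"
  "deval dPhi2 (probe_jet a b c s r) = 1/3 * c 2 - 2/3 * a 2 + b 2"
  "deval dPhi3 (probe_jet a b c s r) = 2/9 * b 3 - 4/9 * a 3"
  "deval dPhi4 (probe_jet a b c s r) = 1/9 * b 4 - 1/9 * a 4 - 2/9 * s * s"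
  "deval dPhi5 (probe_jet a b c s r) = 2/9 * s * r"
  "deval dPhi6 (probe_jet a b c s r) = - 2/27 * r * r"
  by (simp_all add: probe_jet_def mi_eq_iff lazy_eval cong: deval_lazy_cong mult_lazy_cong) (simp add: field_simps)+

lemma deval_probe_jet_F2:
  "deval dPhi3 (probe_jet_F2 c) = - 2/9 * c 3"
  "deval dPhi4 (probe_jet_F2 c) = - 1/9 * c 4"
  by (simp_all add: probe_jet_F2_def mi_eq_iff lazy_eval cong: deval_lazy_cong mult_lazy_cong)

lemma mi_order_mi: "mi_order (mi a b c d) = a + b + c + d"
  by (simp add: mi_order_def mi_def sum_UNIV_4)

text \<open>A bound below \<open>k\<close> would force equal values at \<open>j\<close> and
  \<open>j'\<close>, which differ only in coordinates of \<open>u\<close> of order at least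
  \<open>k\<close>.\<close>

lemma has_orderI:
  assumes "order_le u k f" "\<And>v \<alpha>. v \<noteq> u \<or> mi_order \<alpha> < k \<Longrightarrow> j v \<alpha> = j' v \<alpha>" "f j \<noteq> f j'"
  shows "has_order u k f"
  unfolding has_order_def
proof (intro conjI allI impI notI)
  fix k' assume "k' < k" "order_le u k' f"
  then have "f j = f j'"
    unfolding order_le_def using assms(2) by (meson le_less_trans)
  with assms(3) show False ..
qed (rule assms(1))

lemma order_le_dPhi:
  "i < 7 \<Longrightarrow> order_le Unk_E 2 (deval (dPhi i))"
  "i < 7 \<Longrightarrow> order_le Unk_F1 3 (deval (dPhi i))"
  "i < 7 \<Longrightarrow> order_le Unk_F2 3 (deval (dPhi i))"
  using dord_Phi[of i Unk_E] dord_Phi[of i Unk_F1] dord_Phi[of i Unk_F2]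
  by (simp_all add: order_le_deval coeff_order_def eval_nat_numeral)

lemma has_order_dPhi:
  assumes "i < 5"
  shows "has_order Unk_E 2 (deval (dPhi i))" "has_order Unk_F1 3 (deval (dPhi i))"
    "has_order Unk_F2 3 (deval (dPhi i))"
proof -
  have i7: "i < 7" using assms by simp
  have i: "i = 0 \<or> i = 1 \<or> i = 2 \<or> i = 3 \<or> i = 4" using assms by linarith
  let ?z = "\<lambda>_. 0 :: real" and ?o = "\<lambda>_. 1 :: real"
  show "has_order Unk_E 2 (deval (dPhi i))"
  proof (rule has_orderI[OF order_le_dPhi(1)[OF i7]])
    show "probe_jet ?o ?z ?z 0 0 v \<alpha> = probe_jet ?z ?z ?z 0 0 v \<alpha>"
      if "v \<noteq> Unk_E \<or> mi_order \<alpha> < 2" for v \<alpha>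
      using that by (cases v) (auto simp: probe_jet_def mi_order_mi)
    show "deval (dPhi i) (probe_jet ?o ?z ?z 0 0) \<noteq> deval (dPhi i) (probe_jet ?z ?z ?z 0 0)"
      using i by (elim disjE) (simp_all add: dPhi_def deval_probe_jet)
  qed
  show "has_order Unk_F1 3 (deval (dPhi i))"
  proof (rule has_orderI[OF order_le_dPhi(2)[OF i7]])
    show "probe_jet ?z ?o ?z 0 0 v \<alpha> = probe_jet ?z ?z ?z 0 0 v \<alpha>"
      if "v \<noteq> Unk_F1 \<or> mi_order \<alpha> < 3" for v \<alpha>
      using that by (cases v) (auto simp: probe_jet_def mi_order_mi)
    show "deval (dPhi i) (probe_jet ?z ?o ?z 0 0) \<noteq> deval (dPhi i) (probe_jet ?z ?z ?z 0 0)"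
      using i by (elim disjE) (simp_all add: dPhi_def deval_probe_jet)
  qed
  show "has_order Unk_F2 3 (deval (dPhi i))"
  proof (cases "i < 3")
    case True
    show ?thesis
    proof (rule has_orderI[OF order_le_dPhi(3)[OF i7]])
      show "probe_jet ?z ?z ?o 0 0 v \<alpha> = probe_jet ?z ?z ?z 0 0 v \<alpha>"
        if "v \<noteq> Unk_F2 \<or> mi_order \<alpha> < 3" for v \<alpha>
        using that by (cases v) (auto simp: probe_jet_def mi_order_mi)
      show "deval (dPhi i) (probe_jet ?z ?z ?o 0 0) \<noteq> deval (dPhi i) (probe_jet ?z ?z ?z 0 0)"
        using i True by (elim disjE) (simp_all add: dPhi_def deval_probe_jet)
    qed
  next
    case False
    show ?thesis
    proof (rule has_orderI[OF order_le_dPhi(3)[OF i7]])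
      show "probe_jet_F2 ?o v \<alpha> = probe_jet_F2 ?z v \<alpha>"
        if "v \<noteq> Unk_F2 \<or> mi_order \<alpha> < 3" for v \<alpha>
        using that by (cases v) (auto simp: probe_jet_F2_def mi_order_mi)
      show "deval (dPhi i) (probe_jet_F2 ?o) \<noteq> deval (dPhi i) (probe_jet_F2 ?z)"
        using i False by (elim disjE) (simp_all add: dPhi_def deval_probe_jet_F2)
    qed
  qed
qed

lemma dPhi_linearly_independent:
  fixes c :: "nat \<Rightarrow> real"
  assumes "\<forall>j. (\<Sum>i<7. c i * deval (dPhi i) j) = 0" "i < 7"
  shows "c i = 0"
proof -
  have eq: "c 0 * deval dPhi0 j + c 1 * deval dPhi1 j + c 2 * deval dPhi2 j + c 3 * deval dPhi3 j
      + c 4 * deval dPhi4 j + c 5 * deval dPhi5 j + c 6 * deval dPhi6 j = 0" for j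
    using spec[OF assms(1), of j] by (simp add: dPhi_def eval_nat_numeral)
  let ?z = "\<lambda>_. 0 :: real" and ?d = "\<lambda>i k. of_bool (k = i) :: real"
  \<comment> \<open>A jet with a single nonzero entry of \<open>a\<close> isolates one of the first
    five polynomials. Then \<open>r = 1\<close>, \<open>s = 0\<close> isolates \<open>dPhi6\<close>;
    the jet \<open>s = r = 1\<close> comes last, because \<open>dPhi4\<close> and
    \<open>dPhi6\<close> are nonzero there too.\<close>
  have c: "c 0 = 0" "c 1 = 0" "c 2 = 0" "c 3 = 0" "c 4 = 0"
    using eq[of "probe_jet (?d 0) ?z ?z 0 0"] eq[of "probe_jet (?d 1) ?z ?z 0 0"]
      eq[of "probe_jet (?d 2) ?z ?z 0 0"] eq[of "probe_jet (?d 3) ?z ?z 0 0"]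
      eq[of "probe_jet (?d 4) ?z ?z 0 0"]
    by (simp_all add: deval_probe_jet)
  moreover have c6: "c 6 = 0"
    using eq[of "probe_jet ?z ?z ?z 0 1"] c by (simp add: deval_probe_jet)
  moreover have "c 5 = 0"
    using eq[of "probe_jet ?z ?z ?z 1 1"] c c6 by (simp add: deval_probe_jet)
  moreover have "i = 0 \<or> i = 1 \<or> i = 2 \<or> i = 3 \<or> i = 4 \<or> i = 5 \<or> i = 6"
    using assms(2) by linarith
  ultimately show ?thesis by blast
qed

section \<open>Differential polynomials along smooth functions\<close>

lemma dd_nth: "dd i $ j = of_bool (i = j)"
  by (simp add: dd_def axis_def)

lemma smooth_on_pd: "smooth_on U f \<Longrightarrow> smooth_on U (pd i f)"
  unfolding pd_def vact_def by (rule smooth_on_frechet_derivative)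

lemma smooth_on_funpow_pd: "smooth_on U f \<Longrightarrow> smooth_on U ((pd i ^^ k) f)"
  by (induction k) (simp_all add: smooth_on_pd)

lemma smooth_on_mixed_pd: "smooth_on U f \<Longrightarrow> smooth_on U (mixed_pd \<alpha> f)"
  unfolding mixed_pd_def by (intro smooth_on_funpow_pd)

lemma frechet_derivative_eq_on_open:
  assumes "open U" "smooth_on U f" "\<And>x. x \<in> U \<Longrightarrow> f x = g x" "x \<in> U"
  shows "frechet_derivative f (at x) = frechet_derivative g (at x)"
  using frechet_derivative_transform_within_open[OF smooth_on_differentiable[OF assms(2,4)] assms(1,4)]
    assms(3) by blast

lemma pd_eq_on_open:
  assumes "open U" "smooth_on U f" "\<And>x. x \<in> U \<Longrightarrow> f x = g x" "x \<in> U"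
  shows "pd i f x = pd i g x"
  unfolding pd_def vact_def using frechet_derivative_eq_on_open[OF assms] by simp

lemma funpow_pd_eq_on_open:
  assumes "open U" "smooth_on U f" "\<And>x. x \<in> U \<Longrightarrow> f x = g x" "x \<in> U"
  shows "(pd i ^^ k) f x = (pd i ^^ k) g x"
  using assms(4)
proof (induction k arbitrary: x)
  case (Suc k)
  show ?case
    using pd_eq_on_open[OF assms(1) smooth_on_funpow_pd[OF assms(2)], where g = "(pd i ^^ k) g"] Suc by simp
qed (use assms in simp)

lemma pd_commute:
  "open U \<Longrightarrow> smooth_on U f \<Longrightarrow> x \<in> U \<Longrightarrow> pd i (pd j f) x = pd j (pd i f) x"
  unfolding pd_def vact_def by (rule frechet_derivative_commute)

lemma pd_funpow_pd:
  assumes "open U" "smooth_on U f" "x \<in> U"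
  shows "pd j ((pd i ^^ k) f) x = (pd i ^^ k) (pd j f) x"
  using assms(3)
proof (induction k arbitrary: x)
  case (Suc k)
  have "pd j (pd i ((pd i ^^ k) f)) x = pd i (pd j ((pd i ^^ k) f)) x"
    by (rule pd_commute[OF assms(1) smooth_on_funpow_pd[OF assms(2)] Suc.prems])
  also have "\<dots> = pd i ((pd i ^^ k) (pd j f)) x"
    by (rule pd_eq_on_open[OF assms(1) smooth_on_pd[OF smooth_on_funpow_pd[OF assms(2)]] Suc.IH Suc.prems])
  finally show ?case by simp
qed simp

text \<open>\<open>mixed_pd\<close> has its blocks in a fixed order, index 0 outermost. The new
  derivative is moved inwards past the blocks of smaller index until it meets its own; facts 1, 2
  and 3 pass one, two and three blocks.\<close>

lemma pd_mixed_pd: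
  assumes U: "open U" and f: "smooth_on U f" and x: "x \<in> U"
  shows "pd i (mixed_pd \<alpha> f) x = mixed_pd (\<alpha>(i := Suc (\<alpha> i))) f x"
proof -
  note sm = smooth_on_funpow_pd smooth_on_pd f
  let ?f3 = "(pd 3 ^^ \<alpha> 3) f" and ?f2 = "(pd 2 ^^ \<alpha> 2) ((pd 3 ^^ \<alpha> 3) f)"
  let ?f1 = "(pd 1 ^^ \<alpha> 1) ((pd 2 ^^ \<alpha> 2) ((pd 3 ^^ \<alpha> 3) f))"
  note past0 = pd_funpow_pd[OF U, where f = "?f1" and i = 0 and k = "\<alpha> 0"]
  note past1 = pd_funpow_pd[OF U, where f = "?f2" and i = 1 and k = "\<alpha> 1"]
  note past2 = pd_funpow_pd[OF U, where f = "?f3" and i = 2 and k = "\<alpha> 2"]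
  have 1: "pd j (mixed_pd \<alpha> f) x = (pd 0 ^^ \<alpha> 0) (pd j ?f1) x" for j
    unfolding mixed_pd_def by (rule past0) (use x in \<open>intro sm | assumption\<close>)+
  have 2: "pd j (mixed_pd \<alpha> f) x = (pd 0 ^^ \<alpha> 0) ((pd 1 ^^ \<alpha> 1) (pd j ?f2)) x" for j
    unfolding 1 by (rule funpow_pd_eq_on_open[OF U _ past1 x]) (intro sm | assumption)+
  have "pd j ?f1 y = (pd 1 ^^ \<alpha> 1) ((pd 2 ^^ \<alpha> 2) (pd j ?f3)) y" if "y \<in> U" for j y
    using past1[OF _ that, of j] funpow_pd_eq_on_open[OF U _ past2 that] by (simp add: sm)
  then have 3: "pd j (mixed_pd \<alpha> f) x = (pd 0 ^^ \<alpha> 0) ((pd 1 ^^ \<alpha> 1) ((pd 2 ^^ \<alpha> 2) (pd j ?f3))) x" for j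
    unfolding 1 by (intro funpow_pd_eq_on_open[OF U _ _ x]) (intro sm | assumption)+
  consider "i = 0" | "i = 1" | "i = 2" | "i = 3"
    using exhaust_4[of i] four_eq_zero by metis
  then show ?thesis
  proof cases
    case 1
    then show ?thesis by (simp add: mixed_pd_def)
  next
    case 2
    then show ?thesis unfolding 1 by (simp add: mixed_pd_def)
  next
    case 3
    then show ?thesis unfolding 2 by (simp add: mixed_pd_def)
  next
    case 4
    then show ?thesis unfolding 3 by (simp add: mixed_pd_def)
  qed
qed

section \<open>Evaluation along smooth functions\<close>

locale smooth_triple =
  fixes U :: "(real^4) set" and E F1 F2 :: "real^4 \<Rightarrow> real"
  assumes open_U: "open U"
    and smooth: "smooth_on U E" "smooth_on U F1" "smooth_on U F2"
begin

abbreviation ev :: "dpoly \<Rightarrow> real^4 \<Rightarrow> real" where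
  "ev p x \<equiv> deval p (jet_of E F1 F2 x)"

lemma ev_unk: "ev (unk u) x = (case u of Unk_E \<Rightarrow> E | Unk_F1 \<Rightarrow> F1 | Unk_F2 \<Rightarrow> F2) x"
  by (simp add: unk_def jet_of_def mixed_pd_def)

text \<open>The derivative rules for sums and products use smoothness of the parts, which the joint
  induction supplies. At a coordinate the rule is \<open>pd_mixed_pd\<close>.\<close>

lemma ev_smooth_and_pd:
  "smooth_on U (ev p) \<and> (\<forall>x\<in>U. \<forall>i. pd i (ev p) x = ev (total_deriv i p) x)"
proof (induction p)
  case (DConst c)
  show ?case by (simp add: smooth_on_const pd_def vact_def)
next
  case (DCoord u \<alpha>)
  let ?f = "case u of Unk_E \<Rightarrow> E | Unk_F1 \<Rightarrow> F1 | Unk_F2 \<Rightarrow> F2"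
  have f: "smooth_on U ?f" using smooth by (cases u) auto
  have ev: "ev (DCoord u \<alpha>) = mixed_pd \<alpha> ?f" for \<alpha>
    by (simp add: jet_of_def)
  show ?case
    unfolding total_deriv.simps ev
    using smooth_on_mixed_pd[OF f] pd_mixed_pd[OF open_U f] ev[THEN fun_cong] by metis
next
  case (DAdd p q)
  have d: "(ev (p \<oplus>\<^sub>d q) has_derivative
      (\<lambda>v. frechet_derivative (ev p) (at x) v + frechet_derivative (ev q) (at x) v)) (at x)"
    if "x \<in> U" for x
    using has_derivative_add[OF smooth_on_has_derivative smooth_on_has_derivative] DAdd that
    by fastforce
  have "pd i (ev (p \<oplus>\<^sub>d q)) x = pd i (ev p) x + pd i (ev q) x" if "x \<in> U" for x i
    unfolding pd_def vact_def frechet_derivative_at[OF d[OF that], symmetric] ..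
  with DAdd show ?case by (simp add: smooth_on_add open_U)
next
  case (DMult p q)
  have d: "(ev (p \<otimes>\<^sub>d q) has_derivative
      (\<lambda>v. ev p x * frechet_derivative (ev q) (at x) v + frechet_derivative (ev p) (at x) v * ev q x)) (at x)"
    if "x \<in> U" for x
    using has_derivative_mult[OF smooth_on_has_derivative smooth_on_has_derivative] DMult that
    by fastforce
  have "pd i (ev (p \<otimes>\<^sub>d q)) x = ev p x * pd i (ev q) x + pd i (ev p) x * ev q x" if "x \<in> U" for x i
    unfolding pd_def vact_def frechet_derivative_at[OF d[OF that], symmetric] ..
  with DMult show ?case by (simp add: smooth_on_mult open_U)
qed

lemma smooth_on_ev: "smooth_on U (ev p)"
  using ev_smooth_and_pd by blast

lemma pd_ev: "x \<in> U \<Longrightarrow> pd i (ev p) x = ev (total_deriv i p) x"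
  using ev_smooth_and_pd by blast

lemma frechet_derivative_ev:
  assumes "x \<in> U"
  shows "frechet_derivative (ev p) (at x) v =
    v $ 0 * ev (total_deriv 0 p) x + v $ 1 * ev (total_deriv 1 p) x
    + v $ 2 * ev (total_deriv 2 p) x + v $ 3 * ev (total_deriv 3 p) x"
proof -
  have lin: "linear (frechet_derivative (ev p) (at x))"
    by (rule has_derivative_linear[OF smooth_on_has_derivative[OF smooth_on_ev assms]])
  have "v = (\<Sum>i\<in>UNIV. v $ i *\<^sub>R dd i)"
    by (simp add: vec_eq_iff dd_nth)
  then have "frechet_derivative (ev p) (at x) v = frechet_derivative (ev p) (at x) (\<Sum>i\<in>UNIV. v $ i *\<^sub>R dd i)"
    by (rule arg_cong)
  also have "\<dots> = (\<Sum>i\<in>UNIV. v $ i * pd i (ev p) x)"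
    by (simp add: linear_sum[OF lin] linear_scale[OF lin] pd_def vact_def)
  finally show ?thesis
    unfolding pd_ev[OF assms] sum_UNIV_4 by simp
qed

text \<open>Agreement is asked on \<open>U\<close> only, where the unknowns are smooth;
  \<open>U\<close> being open, it still determines derivatives at points of
  \<open>U\<close>.\<close>

definition represents :: "dpoly \<Rightarrow> (real^4 \<Rightarrow> real) \<Rightarrow> bool" where
  "represents p g \<longleftrightarrow> (\<forall>y\<in>U. g y = ev p y)"

lemma vact_represented:
  assumes "x \<in> U" "represents p g"
  shows "vact X g x =
    X x $ 0 * ev (total_deriv 0 p) x + X x $ 1 * ev (total_deriv 1 p) x
    + X x $ 2 * ev (total_deriv 2 p) x + X x $ 3 * ev (total_deriv 3 p) x"
proof -
  have "frechet_derivative (ev p) (at x) = frechet_derivative g (at x)"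
    using frechet_derivative_eq_on_open[OF open_U smooth_on_ev _ assms(1), of p g] assms(2)
    by (simp add: represents_def)
  then show ?thesis
    unfolding vact_def using frechet_derivative_ev[OF assms(1)] by metis
qed

lemma represents_unknown: "represents dE E" "represents (unk Unk_F1) F1" "represents (unk Unk_F2) F2"
  by (simp_all add: represents_def ev_unk)

lemma K1_nth: "K1 E x $ 0 = 0" "K1 E x $ 1 = 1" "K1 E x $ 2 = 0" "K1 E x $ 3 = ev dE x"
  by (simp_all add: K1_def dd_nth ev_unk)

lemma represents_PQST:
  "represents dP (funP E F1)" "represents dQ (funQ E F2)"
  "represents dS (funS F1)" "represents dT (funT F2)"
  unfolding funP_def funQ_def funS_def funT_def represents_def
  by (simp_all add: vact_represented[OF _ represents_unknown(2)] vact_represented[OF _ represents_unknown(3)]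
      K1_nth dP_def dQ_def dS_def dT_def dK1_def dR1_def R1_def dd_nth)

lemma coeff_fun_eq:
  assumes "x \<in> U"
  shows "funP E F1 x = ev dP x" "funQ E F2 x = ev dQ x" "funS F1 x = ev dS x" "funT F2 x = ev dT x"
    "E x = ev dE x"
  using represents_PQST represents_unknown(1) assms by (simp_all add: represents_def)

lemma Kl_nth:
  assumes "x \<in> U"
  shows "Kl E F1 F2 l x $ 0 = l" "Kl E F1 F2 l x $ 1 = 1 + l * ev dQ x"
    "Kl E F1 F2 l x $ 2 = l * ev dE x" "Kl E F1 F2 l x $ 3 = ev dE x + l * ev dP x"
  by (simp_all add: Kl_def K1_nth K2_def dd_nth coeff_fun_eq[OF assms])

lemma Rl_nth:
  assumes "x \<in> U"
  shows "Rl E F1 F2 l x $ 0 = 0" "Rl E F1 F2 l x $ 1 = l * ev dT x + l\<^sup>2 / 3"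
    "Rl E F1 F2 l x $ 2 = l" "Rl E F1 F2 l x $ 3 = 1 + l * ev dS x + l\<^sup>2 / 3 * ev dE x"
  by (simp_all add: Rl_def R1_def K1_nth R2_def dd_nth coeff_fun_eq[OF assms])

lemma vact_Kl:
  assumes "x \<in> U" "represents p g"
  shows "vact (Kl E F1 F2 l) g x = ev (dK1 p) x + l * ev (dK2 p) x"
  unfolding vact_represented[OF assms] Kl_nth[OF assms(1)] by (simp add: dK1_def dK2_def algebra_simps)

lemma vact_Rl:
  assumes "x \<in> U" "represents p g"
  shows "vact (Rl E F1 F2 l) g x = ev (dR1 p) x + l * ev (dR2 p) x + l\<^sup>2 / 3 * ev (dK1 p) x"
  unfolding vact_represented[OF assms] Rl_nth[OF assms(1)] by (simp add: dR1_def dK1_def dR2_def algebra_simps)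

lemma psi_eq: "x \<in> U \<Longrightarrow> psi E F1 F2 l x = ev (dK1 dE) x + l * ev (dK2 dE) x"
  unfolding psi_def by (rule vact_Kl[OF _ represents_unknown(1)])

lemma xi_eq: "x \<in> U \<Longrightarrow> xi E F1 F2 l x = ev dxi0 x + l * ev dxi1 x + l\<^sup>2 * ev dxi2 x"
  unfolding xi_def vact_Rl[OF _ represents_unknown(1)] dxi0_def dxi1_def dxi2_def by simp

text \<open>\<open>[R\<^sub>1,K\<^sub>1] = R\<^sub>1(E) R\<^sub>1\<close> applied to \<open>F\<^sup>2\<close> and \<open>F\<^sup>1\<close>: the terms of \<open>\<eta>\<close> and \<open>\<phi>\<close> that are constant
  in \<open>\<lambda>\<close>.\<close>

lemma bracket_K1_R1_F:
  "ev (dK1 dT) x - ev (dR1 dQ) x + ev dT x * ev dxi0 x = 0"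
  "ev (dK1 dS) x - ev (dR1 dP) x + ev dS x * ev dxi0 x = 0"
  by (simp_all add: dP_def dQ_def dS_def dT_def dxi0_def dK1_def dR1_def unk_def fun_upd_twist[of 1 3])

lemma eta_eq:
  assumes "x \<in> U"
  shows "eta E F1 F2 l x = l * ev deta1 x + l\<^sup>2 * ev deta2 x"
proof -
  have "eta E F1 F2 l x = (ev (dK1 dT) x - ev (dR1 dQ) x + ev dT x * ev dxi0 x)
      + l * ev deta1 x + l\<^sup>2 * ev deta2 x"
    unfolding eta_def vact_Kl[OF assms represents_PQST(4)] vact_Rl[OF assms represents_PQST(2)]
      vact_Rl[OF assms represents_unknown(1)] coeff_fun_eq[OF assms]
    by (simp add: deta1_def deta2_def dxi0_def dxi1_def dxi2_def algebra_simps)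
  then show ?thesis unfolding bracket_K1_R1_F by simp
qed

text \<open>The last three terms of \<open>\<phi>\<close> are exactly \<open>- E \<eta>\<close>; in
  this form \<open>\<phi>\<close> arises from the elimination.\<close>

lemma phi_alt:
  "phi E F1 F2 l x = vact (Kl E F1 F2 l) (funS F1) x - vact (Rl E F1 F2 l) (funP E F1) x
     + funS F1 x * xi E F1 F2 l x - E x * eta E F1 F2 l x"
  by (simp add: phi_def eta_def xi_def algebra_simps)

lemma phi_eq:
  assumes "x \<in> U"
  shows "phi E F1 F2 l x = l * ev dphi1 x + l\<^sup>2 * ev dphi2 x"
proof -
  have "phi E F1 F2 l x = (ev (dK1 dS) x - ev (dR1 dP) x + ev dS x * ev dxi0 x)
      + l * ev dphi1 x + l\<^sup>2 * ev dphi2 x"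
    unfolding phi_alt vact_Kl[OF assms represents_PQST(3)] vact_Rl[OF assms represents_PQST(1)]
      xi_eq[OF assms] eta_eq[OF assms] coeff_fun_eq[OF assms]
    by (simp add: dphi1_def dphi2_def algebra_simps)
  then show ?thesis unfolding bracket_K1_R1_F by simp
qed

section \<open>The polynomials \<open>m\<close> and \<open>n\<close>\<close>

text \<open>With the powers of \<lambda> explicit, the required \<open>m\<close> and
  \<open>n\<close> can be differentiated and serve as smooth witnesses.\<close>

definition m_sol :: "(real^4) \<times> real \<Rightarrow> real" where
  "m_sol p = snd p ^ 3 * ev dm3 (fst p) + snd p ^ 4 * ev dm4 (fst p)"

definition n_sol :: "(real^4) \<times> real \<Rightarrow> real" where
  "n_sol p = snd p ^ 3 * ev dn3 (fst p) + snd p ^ 4 * ev dn4 (fst p)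
     + snd p ^ 5 * ev dn5 (fst p) + snd p ^ 6 * ev dn6 (fst p)"

lemma mn_form_iff:
  "mn_form U E F1 F2 m n \<longleftrightarrow> (\<forall>p \<in> U \<times> UNIV. m p = m_sol p \<and> n p = n_sol p)"
proof -
  have "(m (x, l) = 1/3 * l^3 * psi E F1 F2 l x + l^2 * phi E F1 F2 l x \<and>
     n (x, l) = - (l^2 / 3) * (m (x, l) + 3 * eta E F1 F2 l x + l * xi E F1 F2 l x)) \<longleftrightarrow>
    m (x, l) = m_sol (x, l) \<and> n (x, l) = n_sol (x, l)" if "x \<in> U" for x l
  proof -
    have "1/3 * l^3 * psi E F1 F2 l x + l^2 * phi E F1 F2 l x = m_sol (x, l)"
      unfolding psi_eq[OF that] phi_eq[OF that] m_sol_def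
      by (simp add: dm3_def dm4_def eval_nat_numeral algebra_simps)
    moreover have "- (l^2 / 3) * (m_sol (x, l) + 3 * eta E F1 F2 l x + l * xi E F1 F2 l x) = n_sol (x, l)"
      unfolding xi_eq[OF that] eta_eq[OF that] m_sol_def n_sol_def
      by (simp add: dn3_def dn4_def dn5_def dn6_def eval_nat_numeral algebra_simps)
    ultimately show ?thesis by metis
  qed
  then show ?thesis unfolding mn_form_def by auto
qed

lemma smooth_on_sol: "smooth_on (U \<times> UNIV) m_sol" "smooth_on (U \<times> UNIV) n_sol"
proof -
  have UR: "open (U \<times> (UNIV :: real set))" by (simp add: open_Times open_U)
  show "smooth_on (U \<times> UNIV) m_sol" "smooth_on (U \<times> UNIV) n_sol"
    unfolding m_sol_def n_sol_def
    by (intro smooth_on_add smooth_on_mult smooth_on_power smooth_on_snd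
        smooth_on_compose_fst smooth_on_ev open_U UR)+
qed

end

section \<open>The Lie bracket\<close>

text \<open>The hypotheses are components 0 to 3 of \<open>[L0,L1] = a L0 + b L1\<close>, with
  \<open>kT\<close> for \<open>K\<^sub>\<lambda>(T)\<close>, \<open>rQ\<close> for
  \<open>R\<^sub>\<lambda>(Q)\<close> and so on. Components 0 and 2 express \<open>n\<close> and
  \<open>m\<close> by \<open>a\<close> and \<open>b\<close>; components 1 and 3 then determine
  \<open>a\<close> and \<open>b\<close>. Nothing is divided by \<open>l\<close>, so
  \<open>l = 0\<close> is covered.\<close>

lemma tangency_imp_coefficients:
  fixes a b l E P Q S T m n kT rQ kS rP psi xi :: real
  assumes "-n = a * l"
    and "m * T + l * kT + 2/3 * l * m - n * Q - l * rQ = a * (1 + l * Q) + b * (l * T + l\<^sup>2 / 3)"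
    and "m - n * E - l * xi = a * (l * E) + b * l"
    and "m * S + l * kS + 2/3 * l * m * E + l\<^sup>2 / 3 * psi - xi - n * P - l * rP
      = a * (E + l * P) + b * (1 + l * S + l\<^sup>2 / 3 * E)"
  shows "m = 1/3 * l^3 * psi + l^2 * (kS - rP + S * xi - E * (kT - rQ + T * xi))"
    and "n = - (l^2 / 3) * (m + 3 * (kT - rQ + T * xi) + l * xi)"
proof -
  have n: "n = - a * l" using assms(1) by simp
  have m: "m = b * l + l * xi" using assms(3) unfolding n by (simp add: algebra_simps)
  have a: "a = l * (kT - rQ + T * xi) + l\<^sup>2 / 3 * b + 2/3 * l\<^sup>2 * xi"
    using assms(2) unfolding n m by (simp add: field_simps power2_eq_square)
  have "b + E * a = l * (kS - rP + S * xi) + l\<^sup>2 / 3 * psi + 2/3 * l\<^sup>2 * xi * E + l\<^sup>2 / 3 * b * E - xi"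
    using assms(4) unfolding n m by (simp add: field_simps power2_eq_square)
  then have b: "b = l * (kS - rP + S * xi - E * (kT - rQ + T * xi)) + l\<^sup>2 / 3 * psi - xi"
    unfolding a by (simp add: algebra_simps)
  show "m = 1/3 * l^3 * psi + l^2 * (kS - rP + S * xi - E * (kT - rQ + T * xi))"
    unfolding m b by (simp add: algebra_simps power2_eq_square power3_eq_cube)
  show "n = - (l^2 / 3) * (m + 3 * (kT - rQ + T * xi) + l * xi)"
    unfolding n a m by (simp add: algebra_simps power2_eq_square)
qed

text \<open>\<open>a\<close> and \<open>b\<close> are the values found in
  \<open>tangency_imp_coefficients\<close>, with \<open>a\<close> rewritten through
  \<open>m = b * l + l * xi\<close> so that \<open>-n = a * l\<close> is immediate.\<close>

lemma coefficients_imp_tangency: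
  fixes l E P Q S T m n kT rQ kS rP psi xi :: real
  assumes m: "m = 1/3 * l^3 * psi + l^2 * (kS - rP + S * xi - E * (kT - rQ + T * xi))"
    and n: "n = - (l^2 / 3) * (m + 3 * (kT - rQ + T * xi) + l * xi)"
  defines "a \<equiv> l * (kT - rQ + T * xi) + l / 3 * m + l\<^sup>2 / 3 * xi"
    and "b \<equiv> l * (kS - rP + S * xi - E * (kT - rQ + T * xi)) + l\<^sup>2 / 3 * psi - xi"
  shows "-n = a * l"
    and "m * T + l * kT + 2/3 * l * m - n * Q - l * rQ = a * (1 + l * Q) + b * (l * T + l\<^sup>2 / 3)"
    and "m - n * E - l * xi = a * (l * E) + b * l"
    and "m * S + l * kS + 2/3 * l * m * E + l\<^sup>2 / 3 * psi - xi - n * P - l * rP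
      = a * (E + l * P) + b * (1 + l * S + l\<^sup>2 / 3 * E)"
proof -
  have m': "m = b * l + l * xi"
    unfolding m b_def by (simp add: algebra_simps power2_eq_square power3_eq_cube)
  show n': "-n = a * l"
    unfolding n a_def by (simp add: algebra_simps power2_eq_square)
  then have n'': "n = - a * l" by simp
  have a: "a = l * (kT - rQ + T * xi) + l\<^sup>2 / 3 * b + 2/3 * l\<^sup>2 * xi"
    unfolding a_def m' by (simp add: algebra_simps power2_eq_square)
  have b: "b + E * a = l * (kS - rP + S * xi) + l\<^sup>2 / 3 * psi + 2/3 * l\<^sup>2 * xi * E + l\<^sup>2 / 3 * b * E - xi"
    unfolding a by (simp add: b_def algebra_simps)
  show "m - n * E - l * xi = a * (l * E) + b * l"
    unfolding n'' m' by (simp add: algebra_simps)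
  show "m * T + l * kT + 2/3 * l * m - n * Q - l * rQ = a * (1 + l * Q) + b * (l * T + l\<^sup>2 / 3)"
    using a unfolding n'' m' by (simp add: field_simps power2_eq_square)
  show "m * S + l * kS + 2/3 * l * m * E + l\<^sup>2 / 3 * psi - xi - n * P - l * rP
      = a * (E + l * P) + b * (1 + l * S + l\<^sup>2 / 3 * E)"
    using b unfolding n'' m' by (simp add: field_simps power2_eq_square)
qed

lemma span_pair_iff: "v \<in> span {a, b} \<longleftrightarrow> (\<exists>r s. v = r *\<^sub>R a + s *\<^sub>R b)"
  for a b v :: "'a::real_vector"
  by (auto simp: span_breakdown_eq algebra_simps)

lemma span_triple_iff: "v \<in> span {a, b, c} \<longleftrightarrow> (\<exists>r s t. v = r *\<^sub>R a + s *\<^sub>R b + t *\<^sub>R c)"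
  for a b c v :: "'a::real_vector"
  by (auto simp: span_breakdown_eq algebra_simps)

section \<open>Components of the bracket\<close>

context smooth_triple
begin

lemma represents_ev: "represents p (ev p)"
  by (simp add: represents_def)

lemma smooth_on_represented: "represents p g \<Longrightarrow> smooth_on U g"
  using smooth_on_cong[OF open_U, of "ev p" g] smooth_on_ev by (simp add: represents_def)

lemma smooth_on_PQST:
  "smooth_on U (funP E F1)" "smooth_on U (funQ E F2)" "smooth_on U (funS F1)" "smooth_on U (funT F2)"
  using smooth_on_represented represents_PQST by blast+

lemma has_derivative_fst_smooth:
  assumes "smooth_on U g" "x \<in> U"
  shows "((\<lambda>p. g (fst p)) has_derivative (\<lambda>w. frechet_derivative g (at x) (fst w))) (at (x, l))"
proof -
  have "(fst has_derivative fst) (at (x, l))"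
    by (rule bounded_linear.has_derivative[OF bounded_linear_fst]) simp
  from has_derivative_compose[OF this, of g] smooth_on_has_derivative[OF assms]
  show ?thesis by simp
qed

lemma frechet_derivative_L0:
  assumes x: "x \<in> U" and m: "m differentiable (at (x, l))"
  shows "frechet_derivative (L0 E F1 F2 m) (at (x, l)) =
    (\<lambda>w. (frechet_derivative E (at x) (fst w) *\<^sub>R dd 3 + snd w *\<^sub>R K2 E F1 F2 x
      + l *\<^sub>R (frechet_derivative E (at x) (fst w) *\<^sub>R dd 2
        + frechet_derivative (funP E F1) (at x) (fst w) *\<^sub>R dd 3
        + frechet_derivative (funQ E F2) (at x) (fst w) *\<^sub>R dd 1),
      frechet_derivative m (at (x, l)) w))"
proof -
  note d = has_derivative_fst_smooth[OF smooth(1) x] has_derivative_fst_smooth[OF smooth_on_PQST(1) x]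
    has_derivative_fst_smooth[OF smooth_on_PQST(2) x]
  have "L0 E F1 F2 m = (\<lambda>p. (dd 1 + E (fst p) *\<^sub>R dd 3 + snd p *\<^sub>R (dd 0 + E (fst p) *\<^sub>R dd 2
      + funP E F1 (fst p) *\<^sub>R dd 3 + funQ E F2 (fst p) *\<^sub>R dd 1), m p))"
    by (auto simp: L0_def Kl_def K1_def K2_def)
  moreover have "(\<dots> has_derivative (\<lambda>w. (frechet_derivative E (at x) (fst w) *\<^sub>R dd 3 + snd w *\<^sub>R K2 E F1 F2 x
      + l *\<^sub>R (frechet_derivative E (at x) (fst w) *\<^sub>R dd 2
        + frechet_derivative (funP E F1) (at x) (fst w) *\<^sub>R dd 3
        + frechet_derivative (funQ E F2) (at x) (fst w) *\<^sub>R dd 1),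
      frechet_derivative m (at (x, l)) w))) (at (x, l))"
    by (rule has_derivative_Pair)
      (auto intro!: derivative_eq_intros d m[THEN frechet_derivative_works[THEN iffD1]]
        simp: K2_def algebra_simps)
  ultimately show ?thesis by (simp only: frechet_derivative_at[symmetric])
qed

lemma frechet_derivative_L1:
  assumes x: "x \<in> U" and n: "n differentiable (at (x, l))"
  shows "frechet_derivative (L1 E F1 F2 n) (at (x, l)) =
    (\<lambda>w. (snd w *\<^sub>R R2 F1 F2 x
      + l *\<^sub>R (frechet_derivative (funS F1) (at x) (fst w) *\<^sub>R dd 3
        + frechet_derivative (funT F2) (at x) (fst w) *\<^sub>R dd 1)
      + (2/3 * l * snd w) *\<^sub>R K1 E x + (l\<^sup>2 / 3 * frechet_derivative E (at x) (fst w)) *\<^sub>R dd 3,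
      frechet_derivative n (at (x, l)) w))"
proof -
  note d = has_derivative_fst_smooth[OF smooth(1) x] has_derivative_fst_smooth[OF smooth_on_PQST(3) x]
    has_derivative_fst_smooth[OF smooth_on_PQST(4) x]
  have "L1 E F1 F2 n = (\<lambda>p. (dd 3 + snd p *\<^sub>R (dd 2 + funS F1 (fst p) *\<^sub>R dd 3 + funT F2 (fst p) *\<^sub>R dd 1)
      + (1/3 * (snd p)\<^sup>2) *\<^sub>R (dd 1 + E (fst p) *\<^sub>R dd 3), n p))"
    by (auto simp: L1_def Rl_def K1_def R1_def R2_def)
  moreover have "(\<dots> has_derivative (\<lambda>w. (snd w *\<^sub>R R2 F1 F2 x
      + l *\<^sub>R (frechet_derivative (funS F1) (at x) (fst w) *\<^sub>R dd 3
        + frechet_derivative (funT F2) (at x) (fst w) *\<^sub>R dd 1)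
      + (2/3 * l * snd w) *\<^sub>R K1 E x + (l\<^sup>2 / 3 * frechet_derivative E (at x) (fst w)) *\<^sub>R dd 3,
      frechet_derivative n (at (x, l)) w))) (at (x, l))"
    by (rule has_derivative_Pair)
      (auto intro!: derivative_eq_intros d n[THEN frechet_derivative_works[THEN iffD1]]
        simp: R2_def K1_def fun_eq_iff vec_eq_iff dd_nth field_simps)
  ultimately show ?thesis by (simp only: frechet_derivative_at[symmetric])
qed

text \<open>In the first four components, \<open>m \<partial>\<^sub>\<lambda>\<close> acting on
  \<open>R\<^sub>\<lambda>\<close> gives \<open>m (R2 + 2/3 l K1)\<close> and
  \<open>n \<partial>\<^sub>\<lambda>\<close> acting on \<open>K\<^sub>\<lambda>\<close> gives
  \<open>- n K2\<close>; the other terms are derivatives of \<open>E\<close>, \<open>P\<close>,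
  \<open>Q\<close>, \<open>S\<close>, \<open>T\<close> along \<open>K\<^sub>\<lambda>\<close> and
  \<open>R\<^sub>\<lambda>\<close>.\<close>

lemma lie_bracket_L0_L1:
  assumes x: "x \<in> U" and m: "m differentiable (at (x, l))" and n: "n differentiable (at (x, l))"
  defines "w \<equiv> fst (lie_bracket (L0 E F1 F2 m) (L1 E F1 F2 n) (x, l))"
  shows "w $ 0 = - n (x, l)"
    and "w $ 1 = m (x, l) * funT F2 x + l * vact (Kl E F1 F2 l) (funT F2) x + 2/3 * l * m (x, l)
      - n (x, l) * funQ E F2 x - l * vact (Rl E F1 F2 l) (funQ E F2) x"
    and "w $ 2 = m (x, l) - n (x, l) * E x - l * xi E F1 F2 l x"
    and "w $ 3 = m (x, l) * funS F1 x + l * vact (Kl E F1 F2 l) (funS F1) x + 2/3 * l * m (x, l) * E x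
      + l\<^sup>2 / 3 * psi E F1 F2 l x - xi E F1 F2 l x - n (x, l) * funP E F1 x
      - l * vact (Rl E F1 F2 l) (funP E F1) x"
    and "snd (lie_bracket (L0 E F1 F2 m) (L1 E F1 F2 n) (x, l)) =
      frechet_derivative n (at (x, l)) (L0 E F1 F2 m (x, l))
      - frechet_derivative m (at (x, l)) (L1 E F1 F2 n (x, l))"
  unfolding w_def lie_bracket_def frechet_derivative_L0[OF x m] frechet_derivative_L1[OF x n]
    xi_def psi_def vact_def
  by (simp_all add: L0_def L1_def K2_def R2_def K1_def dd_nth algebra_simps)

lemma L0_L1_tangency_iff:
  assumes x: "x \<in> U"
  shows "w = a *\<^sub>R Kl E F1 F2 l x + b *\<^sub>R Rl E F1 F2 l x \<longleftrightarrow>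
    w $ 0 = a * l \<and> w $ 1 = a * (1 + l * funQ E F2 x) + b * (l * funT F2 x + l\<^sup>2 / 3) \<and>
    w $ 2 = a * (l * E x) + b * l \<and>
    w $ 3 = a * (E x + l * funP E F1 x) + b * (1 + l * funS F1 x + l\<^sup>2 / 3 * E x)"
  by (simp add: vec_eq_iff all_4_iff Kl_nth[OF x] Rl_nth[OF x] coeff_fun_eq[OF x])

text \<open>\<open>m\<close> and \<open>n\<close> enter the space components undifferentiated, so
  tangency is an algebraic condition on their values at the point.\<close>

lemma fst_bracket_in_span_iff:
  assumes x: "x \<in> U" and m: "m differentiable (at (x, l))" and n: "n differentiable (at (x, l))"
  shows "(\<exists>a b. fst (lie_bracket (L0 E F1 F2 m) (L1 E F1 F2 n) (x, l))
      = a *\<^sub>R Kl E F1 F2 l x + b *\<^sub>R Rl E F1 F2 l x) \<longleftrightarrow>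
    m (x, l) = 1/3 * l^3 * psi E F1 F2 l x + l^2 * phi E F1 F2 l x \<and>
    n (x, l) = - (l^2 / 3) * (m (x, l) + 3 * eta E F1 F2 l x + l * xi E F1 F2 l x)"
    (is "?lhs \<longleftrightarrow> ?rhs")
proof
  note br = lie_bracket_L0_L1[OF x m n]
  note eta = eta_def[of E F1 F2 l, folded xi_def, THEN fun_cong, of x]
  show ?rhs if lhs: ?lhs
  proof -
    obtain a b where *: "fst (lie_bracket (L0 E F1 F2 m) (L1 E F1 F2 n) (x, l))
      = a *\<^sub>R Kl E F1 F2 l x + b *\<^sub>R Rl E F1 F2 l x"
      using lhs by blast
    note t = *[unfolded L0_L1_tangency_iff[OF x] br(1-4)]
    show ?thesis
      unfolding phi_alt eta
      using tangency_imp_coefficients[OF t[THEN conjunct1] t[THEN conjunct2, THEN conjunct1]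
          t[THEN conjunct2, THEN conjunct2, THEN conjunct1] t[THEN conjunct2, THEN conjunct2, THEN conjunct2]]
      by blast
  qed
  show ?lhs if ?rhs
  proof -
    have mn: "m (x, l) = 1/3 * l^3 * psi E F1 F2 l x
        + l^2 * (vact (Kl E F1 F2 l) (funS F1) x - vact (Rl E F1 F2 l) (funP E F1) x
          + funS F1 x * xi E F1 F2 l x
          - E x * (vact (Kl E F1 F2 l) (funT F2) x - vact (Rl E F1 F2 l) (funQ E F2) x
            + funT F2 x * xi E F1 F2 l x))"
      "n (x, l) = - (l^2 / 3) * (m (x, l)
        + 3 * (vact (Kl E F1 F2 l) (funT F2) x - vact (Rl E F1 F2 l) (funQ E F2) x
            + funT F2 x * xi E F1 F2 l x) + l * xi E F1 F2 l x)"
      using that unfolding phi_alt eta by simp_all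
    show ?thesis
      unfolding L0_L1_tangency_iff[OF x] br(1-4)
      using coefficients_imp_tangency[OF mn] by blast
  qed
qed

lemma cond_L_mod_dlam_iff_mn_form:
  assumes m: "smooth_on (U \<times> UNIV) m" and n: "smooth_on (U \<times> UNIV) n"
  shows "cond_L_mod_dlam U E F1 F2 m n \<longleftrightarrow> mn_form U E F1 F2 m n"
proof -
  have "lie_bracket (L0 E F1 F2 m) (L1 E F1 F2 n) (x, l)
        \<in> span {L0 E F1 F2 m (x, l), L1 E F1 F2 n (x, l), dlam} \<longleftrightarrow>
    m (x, l) = 1/3 * l^3 * psi E F1 F2 l x + l^2 * phi E F1 F2 l x \<and>
    n (x, l) = - (l^2 / 3) * (m (x, l) + 3 * eta E F1 F2 l x + l * xi E F1 F2 l x)"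
    if x: "x \<in> U" for x l
  proof -
    have d: "m differentiable (at (x, l))" "n differentiable (at (x, l))"
      using m n x by (auto intro: smooth_on_differentiable)
    let ?v = "lie_bracket (L0 E F1 F2 m) (L1 E F1 F2 n) (x, l)"
    have "?v \<in> span {L0 E F1 F2 m (x, l), L1 E F1 F2 n (x, l), dlam} \<longleftrightarrow>
      (\<exists>a b c. fst ?v = a *\<^sub>R Kl E F1 F2 l x + b *\<^sub>R Rl E F1 F2 l x \<and>
        snd ?v = a * m (x, l) + b * n (x, l) + c)"
      unfolding span_triple_iff by (simp add: prod_eq_iff L0_def L1_def dlam_def)
    \<comment> \<open>The coefficient \<open>c\<close> of \<open>dlam\<close> absorbs the last
      component.\<close>
    also have "\<dots> \<longleftrightarrow> (\<exists>a b. fst ?v = a *\<^sub>R Kl E F1 F2 l x + b *\<^sub>R Rl E F1 F2 l x)"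
    proof -
      have "\<exists>c. snd ?v = r + c" for r :: real
        by (rule exI[of _ "snd ?v - r"]) simp
      then show ?thesis by blast
    qed
    finally show ?thesis
      unfolding fst_bracket_in_span_iff[OF x d] .
  qed
  then show ?thesis unfolding cond_L_mod_dlam_def mn_form_def by auto
qed

lemma cond_L_imp_mn_form:
  assumes m: "smooth_on (U \<times> UNIV) m" and n: "smooth_on (U \<times> UNIV) n" and L: "cond_L U E F1 F2 m n"
  shows "mn_form U E F1 F2 m n"
proof -
  have "span {L0 E F1 F2 m p, L1 E F1 F2 n p} \<subseteq> span {L0 E F1 F2 m p, L1 E F1 F2 n p, dlam}" for p
    by (rule span_mono) auto
  with L have "cond_L_mod_dlam U E F1 F2 m n"
    unfolding cond_L_def cond_L_mod_dlam_def by blast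
  then show ?thesis using cond_L_mod_dlam_iff_mn_form[OF m n] by blast
qed

section \<open>The obstruction along the parameter\<close>

lemma frechet_derivative_sol:
  assumes x: "x \<in> U"
  shows "frechet_derivative m_sol (at (x, l)) w =
      3 * l^2 * snd w * ev dm3 x + l^3 * frechet_derivative (ev dm3) (at x) (fst w)
      + 4 * l^3 * snd w * ev dm4 x + l^4 * frechet_derivative (ev dm4) (at x) (fst w)"
    and "frechet_derivative n_sol (at (x, l)) w =
      3 * l^2 * snd w * ev dn3 x + l^3 * frechet_derivative (ev dn3) (at x) (fst w)
      + 4 * l^3 * snd w * ev dn4 x + l^4 * frechet_derivative (ev dn4) (at x) (fst w)
      + 5 * l^4 * snd w * ev dn5 x + l^5 * frechet_derivative (ev dn5) (at x) (fst w)
      + 6 * l^5 * snd w * ev dn6 x + l^6 * frechet_derivative (ev dn6) (at x) (fst w)"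
proof -
  \<comment> \<open>The exponent is \<open>Suc k\<close>, so instances 2 to 5 are the powers 3 to
    6.\<close>
  have P: "((\<lambda>p. snd p ^ Suc k * ev q (fst p)) has_derivative
      (\<lambda>w. Suc k * l ^ k * snd w * ev q x + l ^ Suc k * frechet_derivative (ev q) (at x) (fst w))) (at (x, l))"
    for k q
  proof (rule has_derivative_eq_rhs)
    have "(snd has_derivative snd) (at (x, l))"
      by (rule bounded_linear.has_derivative[OF bounded_linear_snd]) simp
    then show "((\<lambda>p. snd p ^ Suc k * ev q (fst p)) has_derivative
      (\<lambda>w. snd (x, l) ^ Suc k * frechet_derivative (ev q) (at x) (fst w)
         + of_nat (Suc k) * snd w * snd (x, l) ^ (Suc k - 1) * ev q (fst (x, l)))) (at (x, l))"
      by (intro has_derivative_mult has_derivative_power has_derivative_fst_smooth[OF smooth_on_ev x])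
  qed (simp add: fun_eq_iff algebra_simps)
  note P = P[of 2] P[of 3] P[of 4] P[of 5]
  have "(m_sol has_derivative (\<lambda>w. (3 * l^2 * snd w * ev dm3 x + l^3 * frechet_derivative (ev dm3) (at x) (fst w))
      + (4 * l^3 * snd w * ev dm4 x + l^4 * frechet_derivative (ev dm4) (at x) (fst w)))) (at (x, l))"
    unfolding m_sol_def using has_derivative_add[OF P(1)[of dm3] P(2)[of dm4]] by simp
  from frechet_derivative_at[OF this, symmetric]
  show "frechet_derivative m_sol (at (x, l)) w =
      3 * l^2 * snd w * ev dm3 x + l^3 * frechet_derivative (ev dm3) (at x) (fst w)
      + 4 * l^3 * snd w * ev dm4 x + l^4 * frechet_derivative (ev dm4) (at x) (fst w)"
    by simp
  have "(n_sol has_derivative (\<lambda>w. (3 * l^2 * snd w * ev dn3 x + l^3 * frechet_derivative (ev dn3) (at x) (fst w))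
      + (4 * l^3 * snd w * ev dn4 x + l^4 * frechet_derivative (ev dn4) (at x) (fst w))
      + (5 * l^4 * snd w * ev dn5 x + l^5 * frechet_derivative (ev dn5) (at x) (fst w))
      + (6 * l^5 * snd w * ev dn6 x + l^6 * frechet_derivative (ev dn6) (at x) (fst w)))) (at (x, l))"
    unfolding n_sol_def
    using has_derivative_add[OF has_derivative_add[OF has_derivative_add[OF P(1)[of dn3] P(2)[of dn4]]
          P(3)[of dn5]] P(4)[of dn6]] by simp
  from frechet_derivative_at[OF this, symmetric]
  show "frechet_derivative n_sol (at (x, l)) w =
      3 * l^2 * snd w * ev dn3 x + l^3 * frechet_derivative (ev dn3) (at x) (fst w)
      + 4 * l^3 * snd w * ev dn4 x + l^4 * frechet_derivative (ev dn4) (at x) (fst w)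
      + 5 * l^4 * snd w * ev dn5 x + l^5 * frechet_derivative (ev dn5) (at x) (fst w)
      + 6 * l^5 * snd w * ev dn6 x + l^6 * frechet_derivative (ev dn6) (at x) (fst w)"
    by simp
qed

lemma sum_dPhi:
  "(\<Sum>i<7. l ^ (i + 3) * ev (dPhi i) x) =
    l^3 * ev dPhi0 x + l^4 * ev dPhi1 x + l^5 * ev dPhi2 x + l^6 * ev dPhi3 x + l^7 * ev dPhi4 x
    + l^8 * ev dPhi5 x + l^9 * ev dPhi6 x"
  by (simp add: dPhi_def eval_nat_numeral algebra_simps)

text \<open>Components 0 and 2 of the bracket give \<open>n = - a l\<close> and
  \<open>m = l (b + \<xi>)\<close>, hence \<open>a m + b n = - n \<xi>\<close>. What is left along
  \<open>dlam\<close> is thus the last component of the bracket plus \<open>n \<xi>\<close>, free of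
  \<open>a\<close> and \<open>b\<close>.\<close>

lemma bracket_mod_L0_L1:
  assumes m: "smooth_on (U \<times> UNIV) m" and n: "smooth_on (U \<times> UNIV) n"
    and mn: "mn_form U E F1 F2 m n" and x: "x \<in> U"
  shows "\<exists>a b. lie_bracket (L0 E F1 F2 m) (L1 E F1 F2 n) (x, l) =
    a *\<^sub>R L0 E F1 F2 m (x, l) + b *\<^sub>R L1 E F1 F2 n (x, l)
    + (\<Sum>i<7. l ^ (i + 3) * ev (dPhi i) x) *\<^sub>R dlam"
proof -
  let ?v = "lie_bracket (L0 E F1 F2 m) (L1 E F1 F2 n) (x, l)"
  have UR: "open (U \<times> (UNIV :: real set))" and xl: "(x, l) \<in> U \<times> (UNIV :: real set)"
    using open_U x by (simp_all add: open_Times)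
  have d: "m differentiable (at (x, l))" "n differentiable (at (x, l))"
    using m n x by (auto intro: smooth_on_differentiable)
  have sol: "m (x, l) = m_sol (x, l)" "n (x, l) = n_sol (x, l)"
    using mn x unfolding mn_form_iff by auto
  \<comment> \<open>\<open>m\<close> and \<open>n\<close> equal the explicit polynomials on an open
    set, so their derivatives agree too.\<close>
  have Dsol: "frechet_derivative m (at (x, l)) = frechet_derivative m_sol (at (x, l))"
    "frechet_derivative n (at (x, l)) = frechet_derivative n_sol (at (x, l))"
    using mn frechet_derivative_eq_on_open[OF UR m _ xl] frechet_derivative_eq_on_open[OF UR n _ xl]
    unfolding mn_form_iff by blast+
  obtain a b where ab: "fst ?v = a *\<^sub>R Kl E F1 F2 l x + b *\<^sub>R Rl E F1 F2 l x"
    using fst_bracket_in_span_iff[OF x d] mn x unfolding mn_form_def by blast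
  note t = ab[unfolded L0_L1_tangency_iff[OF x] lie_bracket_L0_L1[OF x d]]
  have nab: "n (x, l) = - a * l" using t by linarith
  have "m (x, l) = b * l + l * xi E F1 F2 l x"
    using t unfolding nab by (simp add: algebra_simps)
  then have "a * m (x, l) + b * n (x, l) = - n (x, l) * xi E F1 F2 l x"
    unfolding nab by (simp add: algebra_simps)
  moreover have "snd ?v + n (x, l) * xi E F1 F2 l x = (\<Sum>i<7. l ^ (i + 3) * ev (dPhi i) x)"
  proof -
    note K = vact_Kl[OF x represents_ev, of l, unfolded vact_def] and R = vact_Rl[OF x represents_ev, of l, unfolded vact_def]
    show ?thesis
      unfolding lie_bracket_L0_L1(5)[OF x d] Dsol sum_dPhi frechet_derivative_sol[OF x]
        sol xi_eq[OF x]
      by (simp add: L0_def L1_def K R sol m_sol_def n_sol_def dPhi_defs eval_nat_numeral algebra_simps)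
  qed
  ultimately have "snd ?v = a * m (x, l) + b * n (x, l) + (\<Sum>i<7. l ^ (i + 3) * ev (dPhi i) x)"
    by linarith
  with ab have "?v = a *\<^sub>R L0 E F1 F2 m (x, l) + b *\<^sub>R L1 E F1 F2 n (x, l)
    + (\<Sum>i<7. l ^ (i + 3) * ev (dPhi i) x) *\<^sub>R dlam"
    by (simp add: prod_eq_iff L0_def L1_def dlam_def)
  then show ?thesis by blast
qed

text \<open>Component 0 gives \<open>a l = 0\<close>, then component 2 gives \<open>b l = 0\<close>;
  components 1 and 3 thereby reduce to \<open>a\<close> and \<open>b\<close>, also at
  \<open>l = 0\<close>.\<close>

lemma Kl_Rl_independent:
  assumes x: "x \<in> U" and "a *\<^sub>R Kl E F1 F2 l x + b *\<^sub>R Rl E F1 F2 l x = 0"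
  shows "a = 0" "b = 0"
proof -
  have "0 = a *\<^sub>R Kl E F1 F2 l x + b *\<^sub>R Rl E F1 F2 l x" using assms(2) by simp
  then have t: "a * l = 0" "a * (1 + l * funQ E F2 x) + b * (l * funT F2 x + l\<^sup>2 / 3) = 0"
    "a * (l * E x) + b * l = 0"
    "a * (E x + l * funP E F1 x) + b * (1 + l * funS F1 x + l\<^sup>2 / 3 * E x) = 0"
    unfolding L0_L1_tangency_iff[OF x] by auto
  have bl: "b * l = 0" using t(1,3) by auto
  show a: "a = 0" using t(1,2) bl by (auto simp: algebra_simps power2_eq_square)
  show "b = 0" using t(4) bl a by (auto simp: algebra_simps power2_eq_square)
qed

text \<open>By independence of \<open>L0\<close> and \<open>L1\<close> modulo \<open>dlam\<close>,
  (L) at a point says that the coefficient of \<open>dlam\<close> vanishes; this polynomial in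
  \<open>l\<close> vanishes for all \<open>l\<close> exactly if its coefficients do.\<close>

lemma cond_L_iff_dPhi:
  assumes m: "smooth_on (U \<times> UNIV) m" and n: "smooth_on (U \<times> UNIV) n" and mn: "mn_form U E F1 F2 m n"
  shows "cond_L U E F1 F2 m n \<longleftrightarrow> (\<forall>i<7. \<forall>x\<in>U. ev (dPhi i) x = 0)"
proof -
  have "lie_bracket (L0 E F1 F2 m) (L1 E F1 F2 n) (x, l) \<in> span {L0 E F1 F2 m (x, l), L1 E F1 F2 n (x, l)}
    \<longleftrightarrow> (\<Sum>i<7. l ^ (i + 3) * ev (dPhi i) x) = 0" if x: "x \<in> U" for x l
  proof -
    let ?c = "\<Sum>i<7. l ^ (i + 3) * ev (dPhi i) x"
    obtain a b where ab: "lie_bracket (L0 E F1 F2 m) (L1 E F1 F2 n) (x, l) =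
        a *\<^sub>R L0 E F1 F2 m (x, l) + b *\<^sub>R L1 E F1 F2 n (x, l) + ?c *\<^sub>R dlam"
      using bracket_mod_L0_L1[OF assms x] by blast
    have "?c = 0" if eq: "a *\<^sub>R L0 E F1 F2 m (x, l) + b *\<^sub>R L1 E F1 F2 n (x, l) + ?c *\<^sub>R dlam
      = r *\<^sub>R L0 E F1 F2 m (x, l) + s *\<^sub>R L1 E F1 F2 n (x, l)" for r s
    proof -
      have "(a - r) *\<^sub>R Kl E F1 F2 l x + (b - s) *\<^sub>R Rl E F1 F2 l x = 0"
        using eq[THEN arg_cong[where f = fst]]
        by (simp add: L0_def L1_def dlam_def algebra_simps)
      then have "a = r" "b = s"
        using Kl_Rl_independent[OF x] by force+
      with eq[THEN arg_cong[where f = snd]] show ?thesis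
        by (simp add: dlam_def)
    qed
    then show ?thesis unfolding span_pair_iff ab by fastforce
  qed
  then have "cond_L U E F1 F2 m n \<longleftrightarrow> (\<forall>x\<in>U. \<forall>l. (\<Sum>i<7. l ^ (i + 3) * ev (dPhi i) x) = 0)"
    unfolding cond_L_def by auto
  also have "\<dots> \<longleftrightarrow> (\<forall>x\<in>U. \<forall>i<7. ev (dPhi i) x = 0)"
  proof (intro ball_cong refl iffI allI impI)
    fix x and i :: nat assume 0: "\<forall>l. (\<Sum>i<7. l ^ (i + 3) * ev (dPhi i) x) = 0" and i: "i < 7"
    \<comment> \<open>Cancelling \<open>l^3\<close> excludes \<open>l = 0\<close>, but infinitely
      many roots remain for a polynomial of degree at most 6.\<close>
    have "(\<Sum>i\<le>6. ev (dPhi i) x * l ^ i) = 0" if "l \<noteq> 0" for l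
    proof -
      have "(\<Sum>i<7. l ^ (i + 3) * ev (dPhi i) x) = l^3 * (\<Sum>i<7. ev (dPhi i) x * l ^ i)"
        by (simp add: sum_distrib_left power_add algebra_simps)
      moreover have "{..<7::nat} = {..6}" by auto
      ultimately show ?thesis using 0 that by simp
    qed
    then have "- {0} \<subseteq> {l. (\<Sum>i\<le>6. ev (dPhi i) x * l ^ i) = 0}" by auto
    moreover have "infinite (- {0::real})"
      by (simp add: infinite_UNIV_char_0)
    ultimately have "\<not> (\<exists>i\<le>6. ev (dPhi i) x \<noteq> 0)"
      using polyfun_finite_roots[of "\<lambda>i. ev (dPhi i) x" 6] infinite_super by blast
    with i show "ev (dPhi i) x = 0" by auto
  qed simp
  finally show ?thesis by blast
qed

text \<open>(L) forces \<open>mn_form\<close>, which fixes \<open>m\<close> and \<open>n\<close> on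
  \<open>U\<close>; conversely \<open>m_sol\<close> and \<open>n_sol\<close> are smooth and of that
  form. This eliminates \<open>m\<close> and \<open>n\<close>.\<close>

lemma ex_cond_L_iff_dPhi:
  "(\<exists>m n. smooth_on (U \<times> UNIV) m \<and> smooth_on (U \<times> UNIV) n \<and> cond_L U E F1 F2 m n)
    \<longleftrightarrow> (\<forall>i<7. \<forall>x\<in>U. ev (dPhi i) x = 0)"
proof
  have "mn_form U E F1 F2 m_sol n_sol" by (simp add: mn_form_iff)
  then show "\<exists>m n. smooth_on (U \<times> UNIV) m \<and> smooth_on (U \<times> UNIV) n \<and> cond_L U E F1 F2 m n"
    if "\<forall>i<7. \<forall>x\<in>U. ev (dPhi i) x = 0"
    using smooth_on_sol cond_L_iff_dPhi that by blast
qed (use cond_L_imp_mn_form cond_L_iff_dPhi in blast)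

end

section \<open>The form of \<open>m\<close> and \<open>n\<close> and the seven equations\<close>

theorem theorem7p3:
  shows "(\<forall>U E F1 F2 m n.
            open U \<and> smooth_on U E \<and> smooth_on U F1 \<and> smooth_on U F2 \<and>
            smooth_on (U \<times> UNIV) m \<and> smooth_on (U \<times> UNIV) n \<longrightarrow>
            (cond_L U E F1 F2 m n \<longrightarrow> mn_form U E F1 F2 m n) \<and>
            (cond_L_mod_dlam U E F1 F2 m n \<longleftrightarrow> mn_form U E F1 F2 m n))
       \<and> (\<exists>\<Phi> :: nat \<Rightarrow> jet \<Rightarrow> real.
            (\<forall>i<7. diff_poly (\<Phi> i) \<and>
                   order_le Unk_E 2 (\<Phi> i) \<and> order_le Unk_F1 3 (\<Phi> i) \<and> order_le Unk_F2 3 (\<Phi> i)) \<and>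
            (\<forall>i<5. has_order Unk_E 2 (\<Phi> i) \<and> has_order Unk_F1 3 (\<Phi> i) \<and> has_order Unk_F2 3 (\<Phi> i)) \<and>
            (\<forall>c :: nat \<Rightarrow> real. (\<forall>j. (\<Sum>i<7. c i * \<Phi> i j) = 0) \<longrightarrow> (\<forall>i<7. c i = 0)) \<and>
            (\<forall>U E F1 F2.
               open U \<and> smooth_on U E \<and> smooth_on U F1 \<and> smooth_on U F2 \<longrightarrow>
               ((\<exists>m n. smooth_on (U \<times> UNIV) m \<and> smooth_on (U \<times> UNIV) n \<and> cond_L U E F1 F2 m n)
                  \<longleftrightarrow> (\<forall>i<7. \<forall>x\<in>U. \<Phi> i (jet_of E F1 F2 x) = 0)) \<and>
               (\<forall>m n. smooth_on (U \<times> UNIV) m \<and> smooth_on (U \<times> UNIV) n \<and> mn_form U E F1 F2 m n \<longrightarrow>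
                  (\<forall>x\<in>U. \<forall>l. \<exists>a b.
                     lie_bracket (L0 E F1 F2 m) (L1 E F1 F2 n) (x, l) =
                       a *\<^sub>R L0 E F1 F2 m (x, l) + b *\<^sub>R L1 E F1 F2 n (x, l) +
                       (\<Sum>i<7. l ^ (i + 3) * \<Phi> i (jet_of E F1 F2 x)) *\<^sub>R dlam))))"
\<comment> \<open>The witnesses are fixed polynomials in jet coordinates, chosen before
  \<open>U\<close> and the unknowns.\<close>
proof (intro conjI allI impI ballI exI[of _ "\<lambda>i. deval (dPhi i)"])
  fix U :: "(real^4) set" and E F1 F2 :: "real^4 \<Rightarrow> real" and m n :: "(real^4) \<times> real \<Rightarrow> real"
  assume *: "open U \<and> smooth_on U E \<and> smooth_on U F1 \<and> smooth_on U F2 \<and>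
    smooth_on (U \<times> UNIV) m \<and> smooth_on (U \<times> UNIV) n"
  then interpret smooth_triple U E F1 F2 by unfold_locales auto
  show "mn_form U E F1 F2 m n" if "cond_L U E F1 F2 m n"
    using cond_L_imp_mn_form that * by blast
  show "cond_L_mod_dlam U E F1 F2 m n \<longleftrightarrow> mn_form U E F1 F2 m n"
    using cond_L_mod_dlam_iff_mn_form * by blast
next
  fix i :: nat
  assume "i < 7"
  then show "order_le Unk_E 2 (deval (dPhi i))" "order_le Unk_F1 3 (deval (dPhi i))"
    "order_le Unk_F2 3 (deval (dPhi i))"
    by (rule order_le_dPhi)+
  show "diff_poly (deval (dPhi i))"
    by (rule diff_poly_deval)
next
  fix i :: nat
  assume "i < 5"
  then show "has_order Unk_E 2 (deval (dPhi i))" "has_order Unk_F1 3 (deval (dPhi i))"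
    "has_order Unk_F2 3 (deval (dPhi i))"
    by (rule has_order_dPhi)+
next
  fix c :: "nat \<Rightarrow> real" and i :: nat
  assume "\<forall>j. (\<Sum>i<7. c i * deval (dPhi i) j) = 0" "i < 7"
  then show "c i = 0"
    by (rule dPhi_linearly_independent)
next
  fix U :: "(real^4) set" and E F1 F2 :: "real^4 \<Rightarrow> real"
  assume "open U \<and> smooth_on U E \<and> smooth_on U F1 \<and> smooth_on U F2"
  then interpret smooth_triple U E F1 F2 by unfold_locales auto
  show "(\<exists>m n. smooth_on (U \<times> UNIV) m \<and> smooth_on (U \<times> UNIV) n \<and> cond_L U E F1 F2 m n)
    \<longleftrightarrow> (\<forall>i<7. \<forall>x\<in>U. deval (dPhi i) (jet_of E F1 F2 x) = 0)"
    by (rule ex_cond_L_iff_dPhi)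
  fix m n :: "(real^4) \<times> real \<Rightarrow> real" and x :: "real^4" and l :: real
  assume "smooth_on (U \<times> UNIV) m \<and> smooth_on (U \<times> UNIV) n \<and> mn_form U E F1 F2 m n" "x \<in> U"
  then show "\<exists>a b. lie_bracket (L0 E F1 F2 m) (L1 E F1 F2 n) (x, l) =
      a *\<^sub>R L0 E F1 F2 m (x, l) + b *\<^sub>R L1 E F1 F2 n (x, l) +
      (\<Sum>i<7. l ^ (i + 3) * deval (dPhi i) (jet_of E F1 F2 x)) *\<^sub>R dlam"
    by (intro bracket_mod_L0_L1) auto
qed

end
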